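(* Let $n, k$ be positive integers such that $k<n/2$. Then the hypergraph $K_n^{\le k}$ is $1$-factorable if and only if one of the following two conditions is met: (i) $n\equiv 0 \pmod k$ and $n\ge k(k-2)$; (ii) $n\equiv -1 \pmod k$ and $n\ge k\left(\lceil \frac{k}{2}\rceil -1\right)-1$.
   Context: A hypergraph $H=(V,E)$ consists of a vertex set $V$ and an edge set $E$ which is a family of non-empty subsets of $V$. A $1$-factor of $H$ is a spanning sub-hypergraph in which every vertex is contained in exactly one edge (i.e. a set of pairwise disjoint edges whose union is $V$). $H$ is $1$-factorable if its edge set $E$ can be partitioned into (edge sets of) $1$-factors. $K_n^{\le k}$ denotes the hypergraph with vertex set $[n]=\{1,\dots,n\}$ whose edges are all non-empty subsets of $[n]$ of size at most $k$. *)

theory Defs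
  imports Complex_Main "HOL-Library.Disjoint_Sets" "HOL-Number_Theory.Cong"
begin

text \<open>A hypergraph is a pair of a vertex set and an edge set; edges form a set, so there are no
  repeated edges.\<close>

type_synonym 'a hypergraph = "'a set \<times> 'a set set"

abbreviation verts :: "'a hypergraph \<Rightarrow> 'a set" where
  "verts \<equiv> fst"

abbreviation edges :: "'a hypergraph \<Rightarrow> 'a set set" where
  "edges \<equiv> snd"

definition is_hypergraph :: "'a hypergraph \<Rightarrow> bool" where
  "is_hypergraph H \<longleftrightarrow> (\<forall>e\<in>edges H. e \<noteq> {} \<and> e \<subseteq> verts H)"

text \<open>A 1-factor is spanning, so it is determined by its edge set \<open>F\<close>.\<close>

definition one_factor :: "'a hypergraph \<Rightarrow> 'a set set \<Rightarrow> bool" where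
  "one_factor H F \<longleftrightarrow> F \<subseteq> edges H \<and> (\<forall>v\<in>verts H. \<exists>!e. e \<in> F \<and> v \<in> e)"

definition one_factorable :: "'a hypergraph \<Rightarrow> bool" where
  "one_factorable H \<longleftrightarrow> (\<exists>P. partition_on (edges H) P \<and> (\<forall>F\<in>P. one_factor H F))"

definition complete_hypergraph_le :: "nat \<Rightarrow> nat \<Rightarrow> nat hypergraph" where
  "complete_hypergraph_le n k = ({1..n}, {e. e \<subseteq> {1..n} \<and> e \<noteq> {} \<and> card e \<le> k})"

lemma is_hypergraph_complete_hypergraph_le: "is_hypergraph (complete_hypergraph_le n k)"
  by (auto simp: is_hypergraph_def complete_hypergraph_le_def)

lemma one_factor_iff:
  assumes "is_hypergraph H"
  shows "one_factor H F \<longleftrightarrow> F \<subseteq> edges H \<and> disjoint F \<and> \<Union>F = verts H"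
proof
  assume F: "one_factor H F"
  have "disjoint F"
  proof (rule disjointI)
    fix a b assume ab: "a \<in> F" "b \<in> F" "a \<noteq> b"
    show "a \<inter> b = {}"
    proof (rule ccontr)
      assume "a \<inter> b \<noteq> {}"
      then obtain v where v: "v \<in> a" "v \<in> b" by blast
      moreover have "v \<in> verts H"
        using v ab F assms unfolding one_factor_def is_hypergraph_def by blast
      ultimately show False
        using F ab unfolding one_factor_def by blast
    qed
  qed
  moreover have "\<Union>F = verts H"
    using F assms unfolding one_factor_def is_hypergraph_def by blast
  ultimately show "F \<subseteq> edges H \<and> disjoint F \<and> \<Union>F = verts H"
    using F unfolding one_factor_def by blast
next
  assume F: "F \<subseteq> edges H \<and> disjoint F \<and> \<Union>F = verts H"
  have "\<exists>!e. e \<in> F \<and> v \<in> e" if "v \<in> verts H" for v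
  proof -
    obtain e where "e \<in> F" "v \<in> e" using F \<open>v \<in> verts H\<close> by blast
    moreover have "e' = e" if "e' \<in> F" "v \<in> e'" for e'
      using F that \<open>e \<in> F\<close> \<open>v \<in> e\<close> disjointD[of F e' e] by blast
    ultimately show ?thesis by blast
  qed
  then show "one_factor H F"
    using F unfolding one_factor_def by blast
qed

end

theory Submission
  imports Defs "HOL-Library.Multiset"
begin

text \<open>
  The sizes of the edges of a \<open>1\<close>-factor form a multiset of numbers in \<open>{1..k}\<close> with sum \<open>n\<close>.
  A \<open>1\<close>-factorization therefore splits the multiset that contains \<open>n choose i\<close> copies of every
  \<open>i \<in> {1..k}\<close> into multisets with sum \<open>n\<close>.  Baranyai's theorem (\<open>baranyai_slots\<close>) says that
  conversely every such splitting comes from a \<open>1\<close>-factorization: the vertices are distributed one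
  after the other, and Hall's theorem keeps the number of edges of each kind exactly balanced.
  What is left is a question about binomial coefficients.

  \<^bold>\<open>Necessity.\<close> Write \<open>n = q * k - s\<close> with \<open>0 \<le> s < k\<close>; then \<open>q \<ge> 3\<close>.  A factor has at least \<open>q\<close>
  edges, hence average edge size at most \<open>n / q\<close>.  But most subsets of size at most \<open>k\<close> have size
  close to \<open>k\<close>, and for \<open>s \<ge> 2\<close> their average size exceeds \<open>n / q\<close> (\<open>average_too_large\<close>), except
  possibly for \<open>q = 3\<close> and \<open>s = 2\<close>, where the sizes are weighted differently.  For \<open>s = 0\<close> a factor either consists of \<open>k\<close>-sets, or it has at
  least \<open>q + 1\<close> edges.  Leaving \<open>k\<close>-sets out of the count gives the same averaging problem for
  \<open>k - 1\<close> and \<open>q + 1\<close>, and \<open>n = (q + 1) * (k - 1) - (k - 1 - q)\<close>, so that a contradiction arises as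
  soon as \<open>k - 1 - q \<ge> 2\<close>.  For \<open>s = 1\<close> a factor with \<open>q\<close> edges consists of \<open>k\<close>-sets and one
  \<open>(k - 1)\<close>-set, so both sizes are left out, and \<open>n = (q + 1) * (k - 2) - (k - 1 - 2 * q)\<close> leads to a
  contradiction if \<open>k - 1 - 2 * q \<ge> 2\<close>.

  \<^bold>\<open>Sufficiency.\<close> Let \<open>n = q * k\<close>.  Among any \<open>k\<close> integers some have a sum divisible by \<open>k\<close>, so the
  sizes below \<open>k\<close> can be cut into groups of at most \<open>k\<close> members with sums divisible by \<open>k\<close>.  If such a
  sum is at most \<open>n\<close>, copies of \<open>k\<close> fill the group up to \<open>n\<close> (\<open>splits_by_padding\<close>).  If \<open>k \<le> q + 2\<close>, the
  sum may be too large only for \<open>k = q + 2\<close>, and then the sizes \<open>k - 1\<close> and \<open>k - 2\<close> are disposed of first.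

  Let \<open>n = q * k - 1\<close> and \<open>k = 2 * r\<close>.  Adding a new point to the edges of odd size turns the edges into
  the non-empty subsets of even size of a set with \<open>q * k\<close> points.  Halving all sizes leads back to the
  previous method, with \<open>r\<close> in place of \<open>k\<close>.

  Let \<open>n = q * k - 1\<close> and \<open>k = 2 * r + 1\<close>.  Here an explicit list of factor types works
  (\<open>splits_odd\<close>): every size below \<open>k - 2\<close> is completed by copies of \<open>k - 2\<close>, \<open>k - 1\<close> and \<open>k\<close>, and the
  multiplicities of a few further types are chosen such that all sizes are used up exactly.
\<close>

section \<open>Hall's marriage theorem\<close>

text \<open>By Rado's argument, a set with two elements \<open>x\<close> and \<open>y\<close> can lose one of them without
  violating Hall's condition.  Otherwise there are index sets \<open>J\<close> and \<open>K\<close> which violate the condition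
  after the removal of \<open>x\<close> and of \<open>y\<close>, and adding up the cardinalities of the union and of the
  intersection of the two neighbourhoods contradicts Hall's condition for \<open>J \<union> K\<close> and
  \<open>J \<inter> K - {i}\<close>.  Removals end with singletons, which are pairwise distinct.\<close>

lemma hall_marriage:
  fixes A :: "'i \<Rightarrow> 'a set"
  assumes "finite I" and "\<And>i. i \<in> I \<Longrightarrow> finite (A i)"
    and "\<And>J. J \<subseteq> I \<Longrightarrow> card J \<le> card (\<Union>(A ` J))"
  shows "\<exists>f. inj_on f I \<and> (\<forall>i\<in>I. f i \<in> A i)"
  using assms(2,3)
proof (induction "\<Sum>i\<in>I. card (A i)" arbitrary: A rule: less_induct)
  case less
  note fin = less.prems(1) and hall = less.prems(2)
  show ?case
  proof (cases "\<exists>i\<in>I. \<exists>x\<in>A i. \<exists>y\<in>A i. x \<noteq> y")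
    case False
    have ne: "A i \<noteq> {}" if "i \<in> I" for i
      using hall[of "{i}"] that by auto
    define f where "f i = (SOME x. x \<in> A i)" for i
    have f: "f i \<in> A i" if "i \<in> I" for i
      using ne[OF that] unfolding f_def by (simp add: some_in_eq)
    have single: "A i = {f i}" if "i \<in> I" for i
      using f[OF that] False that by blast
    have "inj_on f I"
    proof (rule inj_onI, rule ccontr)
      fix i j assume ij: "i \<in> I" "j \<in> I" "f i = f j" "i \<noteq> j"
      have "card {i, j} \<le> card (\<Union>(A ` {i, j}))"
        using ij by (intro hall) auto
      then show False using ij single by simp
    qed
    then show ?thesis using f by blast
  next
    case True
    then obtain i x y where i: "i \<in> I" and xy: "x \<in> A i" "y \<in> A i" "x \<noteq> y" by blast
    define B where "B z = A(i := A i - {z})" for z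
    have sub: "B z j \<subseteq> A j" for z j by (auto simp: B_def)
    have fin': "finite (B z j)" if "j \<in> I" for z j
      using fin[OF that] sub[of z j] finite_subset by blast
    have smaller: "(\<Sum>j\<in>I. card (B z j)) < (\<Sum>j\<in>I. card (A j))" if z: "z \<in> A i" for z
    proof (rule sum_strict_mono_ex1)
      show "\<forall>j\<in>I. card (B z j) \<le> card (A j)"
        by (intro ballI card_mono fin sub)
      have "card (B z i) < card (A i)"
        using fin[OF i] z by (intro psubset_card_mono) (auto simp: B_def)
      then show "\<exists>j\<in>I. card (B z j) < card (A j)" using i by blast
    qed (rule assms(1))
    have removable: "\<exists>z\<in>{x, y}. \<forall>J\<subseteq>I. card J \<le> card (\<Union>(B z ` J))"
    proof (rule ccontr)
      assume "\<not> ?thesis"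
      then obtain J K where J: "J \<subseteq> I" "card (\<Union>(B x ` J)) < card J"
        and K: "K \<subseteq> I" "card (\<Union>(B y ` K)) < card K"
        by (auto simp: not_le)
      have inb: "i \<in> L" if "L \<subseteq> I" "card (\<Union>(B z ` L)) < card L" for L z
      proof (rule ccontr)
        assume "i \<notin> L"
        then have "B z ` L = A ` L" by (auto simp: B_def)
        then show False using hall[of L] that by auto
      qed
      have iJ: "i \<in> J" and iK: "i \<in> K" using inb J K by blast+
      have finJK: "finite J" "finite K"
        using J K assms(1) finite_subset by blast+
      define X where "X = \<Union>(B x ` J)"
      define Y where "Y = \<Union>(B y ` K)"
      have finXY: "finite X" "finite Y"
        unfolding X_def Y_def using finJK J K fin' by auto
      have Bj: "B z j = A j" if "j \<noteq> i" for z j using that by (simp add: B_def)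
      have "A i \<subseteq> B x i \<union> B y i" using xy(3) by (auto simp: B_def)
      then have "A j \<subseteq> X \<union> Y" if "j \<in> J \<union> K" for j
        unfolding X_def Y_def using that iJ iK Bj[of j] by (cases "j = i") blast+
      then have "\<Union>(A ` (J \<union> K)) \<subseteq> X \<union> Y" by blast
      then have "card (\<Union>(A ` (J \<union> K))) \<le> card (X \<union> Y)"
        using finXY by (intro card_mono) auto
      moreover have "card (J \<union> K) \<le> card (\<Union>(A ` (J \<union> K)))"
        using J(1) K(1) by (intro hall) blast
      ultimately have 1: "card (J \<union> K) \<le> card (X \<union> Y)" by linarith
      have "\<Union>(A ` (J \<inter> K - {i})) \<subseteq> X \<inter> Y"
        unfolding X_def Y_def using Bj by blast
      then have "card (\<Union>(A ` (J \<inter> K - {i}))) \<le> card (X \<inter> Y)"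
        using finXY by (intro card_mono) auto
      moreover have "card (J \<inter> K - {i}) \<le> card (\<Union>(A ` (J \<inter> K - {i})))"
        using J(1) by (intro hall) blast
      ultimately have "card (J \<inter> K - {i}) \<le> card (X \<inter> Y)" by linarith
      then have 2: "card (J \<inter> K) \<le> card (X \<inter> Y) + 1"
        using iJ iK finJK by (simp add: card_Diff_singleton)
      have "card X + card Y = card (X \<union> Y) + card (X \<inter> Y)"
        by (rule card_Un_Int[OF finXY])
      moreover have "card J + card K = card (J \<union> K) + card (J \<inter> K)"
        by (rule card_Un_Int[OF finJK])
      ultimately show False
        using 1 2 J(2) K(2) unfolding X_def Y_def by linarith
    qed
    then obtain z where z: "z \<in> A i" "\<And>J. J \<subseteq> I \<Longrightarrow> card J \<le> card (\<Union>(B z ` J))"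
      using xy by blast
    obtain f where "inj_on f I" "\<forall>j\<in>I. f j \<in> B z j"
      using less.hyps[OF smaller[OF z(1)] fin' z(2)] by blast
    then show ?thesis using sub by blast
  qed
qed

section \<open>Baranyai's theorem\<close>

text \<open>The edges to be constructed are represented by abstract slots \<open>x \<in> X\<close>.  A slot belongs to the
  factor \<open>owner x\<close> and shall finally receive \<open>sz x\<close> vertices.  After the vertices below \<open>l\<close> have been
  placed, the slot contains \<open>C x\<close>.  The last condition is what a complete solution would show: a set \<open>T\<close>
  of vertices below \<open>l\<close> extends to \<open>(n - l) choose (i - card T)\<close> subsets of size \<open>i\<close>.\<close>

definition partial_filling ::
  "'x set \<Rightarrow> ('x \<Rightarrow> 'j) \<Rightarrow> ('x \<Rightarrow> nat) \<Rightarrow> 'j set \<Rightarrow> nat set \<Rightarrow> nat \<Rightarrow> nat \<Rightarrow> ('x \<Rightarrow> nat set) \<Rightarrow> bool"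
where
  "partial_filling X owner sz J I n l C \<longleftrightarrow>
     (\<forall>x\<in>X. C x \<subseteq> {..<l}) \<and>
     (\<forall>j\<in>J. \<forall>v<l. \<exists>!x. x \<in> X \<and> owner x = j \<and> v \<in> C x) \<and>
     (\<forall>i\<in>I. \<forall>T\<subseteq>{..<l}. card {x\<in>X. sz x = i \<and> C x = T} =
        (if card T \<le> i then (n - l) choose (i - card T) else 0))"

text \<open>Each factor has to choose the slot that receives the vertex \<open>l\<close>.  If a slot is given the weight
  \<open>(sz x - card (C x)) / (n - l)\<close>, then the weights in each factor add up to \<open>1\<close>, while the weights of all
  slots with the same final size and the same contents add up to an integer, the number of times
  that this class has to be chosen.  So a fractional choice exists, and Hall's theorem, applied to
  factors and to copies of classes, turns it into an integral one.\<close>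

lemma filling_transversal:
  assumes finX: "finite X" and finJ: "finite J"
    and own: "owner ` X \<subseteq> J" and szI: "sz ` X \<subseteq> I"
    and size: "\<And>j. j \<in> J \<Longrightarrow> (\<Sum>x | x \<in> X \<and> owner x = j. sz x) = n"
    and fill: "partial_filling X owner sz J I n l C" and l: "l < n"
  shows "\<exists>f. (\<forall>j\<in>J. f j \<in> X \<and> owner (f j) = j) \<and>
    (\<forall>i\<in>I. \<forall>T\<subseteq>{..<l}. card {j\<in>J. sz (f j) = i \<and> C (f j) = T} =
        (if card T < i then (n - l - 1) choose (i - card T - 1) else 0))"
proof -
  define cls where "cls x = (sz x, C x)" for x
  \<comment> \<open>the number of times that a class, a pair of final size and contents, has to be chosen\<close>
  define cap where "cap c = (if card (snd c) < fst c
     then (n - l - 1) choose (fst c - card (snd c) - 1) else 0)" for c :: "nat \<times> nat set"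
  have Csub: "C x \<subseteq> {..<l}" if "x \<in> X" for x
    using fill that unfolding partial_filling_def by blast
  have uniq: "\<exists>!x. x \<in> X \<and> owner x = j \<and> v \<in> C x" if "j \<in> J" "v < l" for j v
    using fill that unfolding partial_filling_def by blast
  have cnt: "card {x\<in>X. sz x = i \<and> C x = T} =
        (if card T \<le> i then (n - l) choose (i - card T) else 0)" if "i \<in> I" "T \<subseteq> {..<l}" for i T
    using fill that unfolding partial_filling_def by blast
  have capcnt: "(n - l) * cap (i, T) = card {x\<in>X. cls x = (i, T)} * (i - card T)"
    if "i \<in> I" "T \<subseteq> {..<l}" for i T
    using cnt[OF that] times_binomial_minus1_eq[of "i - card T" "n - l"]
    by (auto simp: cap_def cls_def mult.commute[of "(n - l) choose (i - card T)"])
  have le: "card (C x) \<le> sz x" if "x \<in> X" for x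
  proof (rule ccontr)
    assume "\<not> ?thesis"
    then have "card {y\<in>X. sz y = sz x \<and> C y = C x} = 0"
      using cnt[of "sz x" "C x"] that szI Csub by auto
    then show False using that finX by auto
  qed
  have room: "(\<Sum>x | x \<in> X \<and> owner x = j. sz x - card (C x)) = n - l" if j: "j \<in> J" for j
  proof -
    let ?Xj = "{x. x \<in> X \<and> owner x = j}"
    have "(\<Sum>x\<in>?Xj. card (C x)) = card (\<Union>x\<in>?Xj. C x)"
    proof (rule card_UN_disjoint[symmetric])
      show "finite ?Xj" using finX by simp
      show "\<forall>x\<in>?Xj. finite (C x)" using Csub finite_subset by blast
      show "\<forall>x\<in>?Xj. \<forall>y\<in>?Xj. x \<noteq> y \<longrightarrow> C x \<inter> C y = {}"
        using uniq[OF j] Csub by blast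
    qed
    also have "(\<Union>x\<in>?Xj. C x) = {..<l}"
      using uniq[OF j] Csub by blast
    finally have "(\<Sum>x\<in>?Xj. card (C x)) = l" by simp
    then show ?thesis
      using size[OF j] le by (subst sum_subtractf_nat) auto
  qed
  have room': "(\<Sum>x | x \<in> X \<and> owner x \<in> K. sz x - card (C x)) = card K * (n - l)" if K: "K \<subseteq> J" for K
  proof -
    have "finite K" using K finJ finite_subset by blast
    then have "(\<Sum>j\<in>K. \<Sum>x | x \<in> {x \<in> X. owner x \<in> K} \<and> owner x = j. sz x - card (C x)) =
        (\<Sum>x | x \<in> X \<and> owner x \<in> K. sz x - card (C x))"
      using finX by (intro sum.group) auto
    moreover have "{x. x \<in> {x \<in> X. owner x \<in> K} \<and> owner x = j} = {x. x \<in> X \<and> owner x = j}"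
      if "j \<in> K" for j using that by auto
    ultimately have "(\<Sum>x | x \<in> X \<and> owner x \<in> K. sz x - card (C x)) =
        (\<Sum>j\<in>K. \<Sum>x | x \<in> X \<and> owner x = j. sz x - card (C x))"
      by simp
    also have "\<dots> = (\<Sum>j\<in>K. n - l)"
      using K by (intro sum.cong refl room) blast
    finally show ?thesis by simp
  qed
  \<comment> \<open>a class is available to \<open>j\<close> as often as it may be chosen; copies are told apart by \<open>t\<close>\<close>
  define A where "A j = Sigma (cls ` {x\<in>X. owner x = j}) (\<lambda>c. {..<cap c})" for j
  have UA: "\<Union>(A ` K) = Sigma (cls ` {x\<in>X. owner x \<in> K}) (\<lambda>c. {..<cap c})" for K
    unfolding A_def by auto
  have cardUA: "(n - l) * card (\<Union>(A ` K)) =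
      (\<Sum>x | x \<in> X \<and> cls x \<in> cls ` {x\<in>X. owner x \<in> K}. sz x - card (C x))" for K
  proof -
    let ?c = "cls ` {x\<in>X. owner x \<in> K}"
    have "(n - l) * card (\<Union>(A ` K)) = (\<Sum>c\<in>?c. (n - l) * cap c)"
      unfolding UA using finX by (simp add: sum_distrib_left)
    also have "\<dots> = (\<Sum>c\<in>?c. \<Sum>x | x \<in> {x\<in>X. cls x \<in> ?c} \<and> cls x = c. sz x - card (C x))"
    proof (rule sum.cong)
      fix c assume "c \<in> ?c"
      then obtain y where y: "y \<in> X" "c = cls y" "c \<in> ?c" by blast
      have "{x. x \<in> {x\<in>X. cls x \<in> ?c} \<and> cls x = c} = {x\<in>X. cls x = c}"
        using y by blast
      then have "(\<Sum>x | x \<in> {x\<in>X. cls x \<in> ?c} \<and> cls x = c. sz x - card (C x))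
         = (\<Sum>x | x \<in> X \<and> cls x = c. sz y - card (C y))"
        using y by (intro sum.cong) (auto simp: cls_def)
      also have "\<dots> = (n - l) * cap c"
        using capcnt[of "sz y" "C y"] y szI Csub[of y] by (auto simp: cls_def)
      finally show "(n - l) * cap c =
          (\<Sum>x | x \<in> {x\<in>X. cls x \<in> ?c} \<and> cls x = c. sz x - card (C x))" by simp
    qed simp
    also have "\<dots> = (\<Sum>x | x \<in> X \<and> cls x \<in> ?c. sz x - card (C x))"
      using finX by (intro sum.group) auto
    finally show ?thesis .
  qed
  have "\<exists>h. inj_on h J \<and> (\<forall>j\<in>J. h j \<in> A j)"
  proof (rule hall_marriage[OF finJ])
    show "finite (A j)" for j unfolding A_def using finX by auto
    fix K assume K: "K \<subseteq> J"
    have "card K * (n - l) \<le> (n - l) * card (\<Union>(A ` K))"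
      unfolding cardUA room'[OF K, symmetric] using finX by (intro sum_mono2) auto
    then show "card K \<le> card (\<Union>(A ` K))" using l by (simp add: mult.commute)
  qed
  then obtain h where h: "inj_on h J" "\<And>j. j \<in> J \<Longrightarrow> h j \<in> A j" by blast
  \<comment> \<open>for the set of all factors Hall's inequality is an equality, so every copy is chosen\<close>
  have "{x. x \<in> X \<and> cls x \<in> cls ` {x\<in>X. owner x \<in> J}} = {x. x \<in> X \<and> owner x \<in> J}"
    using own by auto
  then have "(n - l) * card (\<Union>(A ` J)) = card J * (n - l)"
    unfolding cardUA room'[OF subset_refl, symmetric] by simp
  then have "card (\<Union>(A ` J)) = card J" using l by simp
  moreover have "finite (\<Union>(A ` J))" unfolding A_def using finJ finX by auto
  moreover have "h ` J \<subseteq> \<Union>(A ` J)" using h(2) by blast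
  ultimately have hJ: "h ` J = \<Union>(A ` J)"
    using h(1) by (intro card_subset_eq) (auto simp: card_image)
  define f where "f j = (SOME x. x \<in> X \<and> owner x = j \<and> cls x = fst (h j))" for j
  have f: "f j \<in> X \<and> owner (f j) = j \<and> cls (f j) = fst (h j)" if "j \<in> J" for j
  proof -
    have "fst (h j) \<in> cls ` {x\<in>X. owner x = j}"
      using h(2)[OF that] unfolding A_def by (cases "h j") auto
    then have "\<exists>x. x \<in> X \<and> owner x = j \<and> cls x = fst (h j)" by auto
    then show ?thesis unfolding f_def by (rule someI_ex)
  qed
  have "card {j\<in>J. cls (f j) = c} = cap c" if c: "fst c \<in> I" "snd c \<subseteq> {..<l}" for c
  proof -
    have "{j\<in>J. cls (f j) = c} = {j\<in>J. fst (h j) = c}"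
      using f by auto
    moreover have "card (h ` {j\<in>J. fst (h j) = c}) = card {j\<in>J. fst (h j) = c}"
      using h(1) by (intro card_image) (auto simp: inj_on_def)
    ultimately have "card {j\<in>J. cls (f j) = c} = card (h ` {j\<in>J. fst (h j) = c})" by simp
    also have "h ` {j\<in>J. fst (h j) = c} = {p \<in> h ` J. fst p = c}" by blast
    also have "{p \<in> h ` J. fst p = c} = (if c \<in> cls ` X then {c} \<times> {..<cap c} else {})"
      unfolding hJ UA using own by auto
    also have "card \<dots> = cap c"
    proof (cases "c \<in> cls ` X")
      case False
      then have "{x\<in>X. cls x = c} = {}" by blast
      then have "(n - l) * cap c = 0"
        using capcnt[of "fst c" "snd c"] c by (metis card.empty mult_is_0 prod.collapse)
      then show ?thesis using False l by simp
    qed (simp add: card_cartesian_product_singleton)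
    finally show ?thesis .
  qed
  from this[of "(i, T)" for i T] have "card {j\<in>J. sz (f j) = i \<and> C (f j) = T} =
        (if card T < i then (n - l - 1) choose (i - card T - 1) else 0)" if "i \<in> I" "T \<subseteq> {..<l}" for i T
    using that by (simp add: cls_def cap_def)
  then show ?thesis using f by (intro exI[of _ f]) blast
qed

lemma filling_step:
  assumes finX: "finite X" and finJ: "finite J"
    and own: "owner ` X \<subseteq> J" and szI: "sz ` X \<subseteq> I"
    and size: "\<And>j. j \<in> J \<Longrightarrow> (\<Sum>x | x \<in> X \<and> owner x = j. sz x) = n"
    and fill: "partial_filling X owner sz J I n l C" and l: "l < n"
  shows "\<exists>C'. partial_filling X owner sz J I n (Suc l) C'"
proof -
  obtain f where f: "\<And>j. j \<in> J \<Longrightarrow> f j \<in> X \<and> owner (f j) = j"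
    and fc: "\<And>i T. i \<in> I \<Longrightarrow> T \<subseteq> {..<l} \<Longrightarrow> card {j\<in>J. sz (f j) = i \<and> C (f j) = T} =
        (if card T < i then (n - l - 1) choose (i - card T - 1) else 0)"
    using filling_transversal[OF assms] by blast
  have Csub: "C x \<subseteq> {..<l}" if "x \<in> X" for x
    using fill that unfolding partial_filling_def by blast
  have uniq: "\<exists>!x. x \<in> X \<and> owner x = j \<and> v \<in> C x" if "j \<in> J" "v < l" for j v
    using fill that unfolding partial_filling_def by blast
  have cnt: "card {x\<in>X. sz x = i \<and> C x = T} =
        (if card T \<le> i then (n - l) choose (i - card T) else 0)" if "i \<in> I" "T \<subseteq> {..<l}" for i T
    using fill that unfolding partial_filling_def by blast
  have finj: "inj_on f J" by (rule inj_onI) (metis f)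
  define C' where "C' x = (if x \<in> f ` J then insert l (C x) else C x)" for x
  have nl: "l \<notin> C x" if "x \<in> X" for x using Csub[OF that] by auto
  have chosen: "card {x \<in> f ` J. sz x = i \<and> C x = T} =
      (if card T < i then (n - l - 1) choose (i - card T - 1) else 0)"
    if "i \<in> I" "T \<subseteq> {..<l}" for i T
  proof -
    have "{x \<in> f ` J. sz x = i \<and> C x = T} = f ` {j\<in>J. sz (f j) = i \<and> C (f j) = T}" by auto
    moreover have "inj_on f {j\<in>J. sz (f j) = i \<and> C (f j) = T}"
      using finj by (auto simp: inj_on_def)
    ultimately show ?thesis using fc[OF that] by (simp add: card_image)
  qed
  have "\<forall>x\<in>X. C' x \<subseteq> {..<Suc l}"
  proof
    fix x assume "x \<in> X"
    then show "C' x \<subseteq> {..<Suc l}" using Csub[of x] lessThan_Suc[of l] unfolding C'_def by (auto split: if_splits)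
  qed
  moreover have "\<exists>!x. x \<in> X \<and> owner x = j \<and> v \<in> C' x" if j: "j \<in> J" and v: "v < Suc l" for j v
  proof (cases "v = l")
    case True
    show ?thesis
    proof (rule ex1I[of _ "f j"])
      show "f j \<in> X \<and> owner (f j) = j \<and> v \<in> C' (f j)"
        using f[OF j] j True by (simp add: C'_def)
      fix x assume x: "x \<in> X \<and> owner x = j \<and> v \<in> C' x"
      then have "x \<in> f ` J" using nl True unfolding C'_def by (auto split: if_splits)
      then show "x = f j" using x f by auto
    qed
  next
    case False
    then have "v \<in> C' x \<longleftrightarrow> v \<in> C x" for x unfolding C'_def by auto
    then show ?thesis using uniq[OF j] False v by auto
  qed
  moreover have "card {x\<in>X. sz x = i \<and> C' x = T} =
        (if card T \<le> i then (n - Suc l) choose (i - card T) else 0)"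
    if i: "i \<in> I" and T: "T \<subseteq> {..<Suc l}" for i T
  proof (cases "l \<in> T")
    case True
    let ?T = "T - {l}"
    have finT: "finite T" using T finite_subset by blast
    have T': "?T \<subseteq> {..<l}" using T by auto
    have iff: "C' x = T \<longleftrightarrow> x \<in> f ` J \<and> C x = ?T" if "x \<in> X" for x
      using True nl[OF that] by (cases "x \<in> f ` J") (auto simp: C'_def)
    have "{x\<in>X. sz x = i \<and> C' x = T} = {x \<in> f ` J. sz x = i \<and> C x = ?T}"
    proof (intro equalityI subsetI)
      fix x assume "x \<in> {x \<in> f ` J. sz x = i \<and> C x = ?T}"
      moreover have "f ` J \<subseteq> X" using f by blast
      ultimately show "x \<in> {x\<in>X. sz x = i \<and> C' x = T}" using iff[of x] by blast
    qed (use iff in blast)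
    moreover have "card T = Suc (card ?T)" using True finT by (simp only: card_Suc_Diff1)
    ultimately show ?thesis using chosen[OF i T'] by simp
  next
    case False
    then have T': "T \<subseteq> {..<l}" using T by (auto simp: less_Suc_eq)
    have iff: "C' x = T \<longleftrightarrow> x \<notin> f ` J \<and> C x = T" if "x \<in> X" for x
      using False by (cases "x \<in> f ` J") (auto simp: C'_def)
    have "{x\<in>X. sz x = i \<and> C' x = T} = {x\<in>X. sz x = i \<and> C x = T} - {x \<in> f ` J. sz x = i \<and> C x = T}"
      using iff by blast
    moreover have "{x \<in> f ` J. sz x = i \<and> C x = T} \<subseteq> {x\<in>X. sz x = i \<and> C x = T}"
      using f by auto
    moreover have "finite {x \<in> f ` J. sz x = i \<and> C x = T}" using finJ by simp
    ultimately have eq: "card {x\<in>X. sz x = i \<and> C' x = T} =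
       card {x\<in>X. sz x = i \<and> C x = T} - card {x \<in> f ` J. sz x = i \<and> C x = T}"
      by (simp only: card_Diff_subset)
    show ?thesis
    proof (cases "card T < i")
      case True
      then obtain e where e: "i - card T = Suc e" by (metis Suc_diff_Suc)
      obtain m where m: "n - l = Suc m" "n - Suc l = m" using l by (metis Suc_diff_Suc)
      show ?thesis using eq cnt[OF i T'] chosen[OF i T'] True e m by simp
    qed (use eq cnt[OF i T'] chosen[OF i T'] in auto)
  qed
  ultimately show ?thesis unfolding partial_filling_def by (intro exI[of _ C']) blast
qed

text \<open>Once all \<open>n\<close> vertices are placed, the counting condition of \<open>partial_filling\<close> says that
  each subset of an admissible size is the content of exactly one slot.\<close>

theorem baranyai_slots:
  assumes finX: "finite X" and finJ: "finite J"
    and own: "owner ` X \<subseteq> J" and szI: "sz ` X \<subseteq> I"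
    and size: "\<And>j. j \<in> J \<Longrightarrow> (\<Sum>x | x \<in> X \<and> owner x = j. sz x) = n"
    and count: "\<And>i. i \<in> I \<Longrightarrow> card {x\<in>X. sz x = i} = n choose i"
  shows "\<exists>C. bij_betw C X {T. T \<subseteq> {..<n} \<and> card T \<in> I} \<and>
     (\<forall>j\<in>J. \<forall>v<n. \<exists>!x. x \<in> X \<and> owner x = j \<and> v \<in> C x)"
proof -
  have "\<exists>C. partial_filling X owner sz J I n l C" if "l \<le> n" for l
    using that
  proof (induction l)
    case 0
    show ?case using count unfolding partial_filling_def by (intro exI[of _ "\<lambda>_. {}"]) auto
  next
    case (Suc l)
    then show ?case using filling_step[OF finX finJ own szI size] by auto
  qed
  then obtain C where fill: "partial_filling X owner sz J I n n C" by blast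
  have Csub: "C x \<subseteq> {..<n}" if "x \<in> X" for x
    using fill that unfolding partial_filling_def by blast
  have cnt: "card {x\<in>X. sz x = i \<and> C x = T} = (if card T = i then 1 else 0)"
    if "i \<in> I" "T \<subseteq> {..<n}" for i T
    using fill that unfolding partial_filling_def by (auto simp: binomial_eq_0)
  have card_C: "card (C x) = sz x" if "x \<in> X" for x
  proof (rule ccontr)
    assume "card (C x) \<noteq> sz x"
    then have "card {y\<in>X. sz y = sz x \<and> C y = C x} = 0"
      using cnt[of "sz x" "C x"] that szI Csub by auto
    then show False using that finX by auto
  qed
  have "inj_on C X"
  proof (rule inj_onI)
    fix x y assume xy: "x \<in> X" "y \<in> X" "C x = C y"
    have "card {z\<in>X. sz z = sz x \<and> C z = C x} = 1"
      using cnt[of "sz x" "C x"] xy szI Csub[of x] card_C[of x] by auto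
    then obtain w where w: "{z\<in>X. sz z = sz x \<and> C z = C x} = {w}" by (auto simp: card_1_singleton_iff)
    have "sz y = sz x" using card_C[OF xy(1)] card_C[OF xy(2)] xy(3) by simp
    then have "x \<in> {z\<in>X. sz z = sz x \<and> C z = C x}" "y \<in> {z\<in>X. sz z = sz x \<and> C z = C x}"
      using xy by auto
    then show "x = y" unfolding w by blast
  qed
  moreover have "C ` X = {T. T \<subseteq> {..<n} \<and> card T \<in> I}"
  proof
    show "C ` X \<subseteq> {T. T \<subseteq> {..<n} \<and> card T \<in> I}" using Csub card_C szI by auto
    show "{T. T \<subseteq> {..<n} \<and> card T \<in> I} \<subseteq> C ` X"
    proof
      fix T assume "T \<in> {T. T \<subseteq> {..<n} \<and> card T \<in> I}"
      then have "card {x\<in>X. sz x = card T \<and> C x = T} = 1" using cnt[of "card T" T] by auto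
      then have "{x\<in>X. sz x = card T \<and> C x = T} \<noteq> {}" by (metis card.empty zero_neq_one)
      then show "T \<in> C ` X" by blast
    qed
  qed
  ultimately show ?thesis
    using fill unfolding partial_filling_def bij_betw_def by blast
qed

section \<open>Sums of binomial coefficients\<close>

lemma binomial_absorb: "(n - i) * (n choose i) = Suc i * (n choose Suc i)"
  by (metis Suc_times_binomial_eq binomial_absorb_comp binomial_absorption mult.commute)

lemma binomial_double:
  assumes "3 * i + 2 \<le> n"
  shows "2 * (n choose i) \<le> n choose Suc i"
proof -
  have "2 * Suc i \<le> n - i" using assms by simp
  then have "2 * Suc i * (n choose i) \<le> Suc i * (n choose Suc i)"
    unfolding binomial_absorb[symmetric] by (rule mult_right_mono) simp
  then have "Suc i * (2 * (n choose i)) \<le> Suc i * (n choose Suc i)"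
    by (simp only: mult.assoc mult.left_commute)
  then show ?thesis by (simp only: Suc_mult_le_cancel1)
qed

lemma sum_binomial_le_double:
  "3 * j \<le> n + 1 \<Longrightarrow> (\<Sum>i\<le>j. n choose i) \<le> 2 * (n choose j)"
proof (induction j)
  case (Suc j)
  then show ?case using binomial_double[of j n] by simp
qed simp

section \<open>Obstructions to factorability\<close>

text \<open>This is the only way in which the assumption of factorability is used: summing a weight over all
  edges, once by factors and once by sizes.\<close>

lemma weight_obstruction:
  fixes w :: "nat \<Rightarrow> int"
  assumes fac: "one_factorable (complete_hypergraph_le n k)"
    and neg: "\<And>F :: nat set set. finite F \<Longrightarrow> (\<And>e. e \<in> F \<Longrightarrow> 0 < card e \<and> card e \<le> k) \<Longrightarrow>
       (\<Sum>e\<in>F. card e) = n \<Longrightarrow> (\<Sum>e\<in>F. w (card e)) \<le> 0"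
  shows "(\<Sum>i=1..k. w i * int (n choose i)) \<le> 0"
proof -
  let ?H = "complete_hypergraph_le n k"
  define E where "E = {e. e \<subseteq> {1..n} \<and> e \<noteq> {} \<and> card e \<le> k}"
  have E: "edges ?H = E" "verts ?H = {1..n}" by (simp_all add: complete_hypergraph_le_def E_def)
  have finE: "finite E" unfolding E_def by simp
  obtain P where P: "partition_on E P" and PF: "\<And>F. F \<in> P \<Longrightarrow> one_factor ?H F"
    using fac unfolding one_factorable_def E by blast
  have F: "F \<subseteq> E \<and> disjoint F \<and> \<Union>F = {1..n}" if "F \<in> P" for F
    using PF[OF that] unfolding one_factor_iff[OF is_hypergraph_complete_hypergraph_le] E .
  have card_pos: "0 < card e" if "e \<in> E" for e
  proof -
    have "finite e" using that finite_subset[of e "{1..n}"] unfolding E_def by simp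
    then show ?thesis using that unfolding E_def by (simp add: card_gt_0_iff)
  qed
  have "(\<Sum>i=1..k. w i * int (n choose i)) = (\<Sum>i\<in>{1..k}. \<Sum>e | e \<in> E \<and> card e = i. w (card e))"
  proof (rule sum.cong)
    fix i assume i: "i \<in> {1..k}"
    then have "{e. e \<in> E \<and> card e = i} = {e. e \<subseteq> {1..n} \<and> card e = i}"
      unfolding E_def by auto
    then have "card {e. e \<in> E \<and> card e = i} = n choose i"
      using n_subsets[of "{1..n}" i] by simp
    then show "w i * int (n choose i) = (\<Sum>e | e \<in> E \<and> card e = i. w (card e))" by simp
  qed simp
  also have "\<dots> = (\<Sum>e\<in>E. w (card e))"
  proof (intro sum.group)
    show "card ` E \<subseteq> {1..k}"
    proof
      fix i assume "i \<in> card ` E"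
      then obtain e where "e \<in> E" "i = card e" by blast
      then show "i \<in> {1..k}" using card_pos[of e] by (simp add: E_def)
    qed
  qed (use finE in auto)
  also have "\<dots> = (\<Sum>e\<in>\<Union>P. w (card e))"
    using P by (simp add: partition_on_def)
  also have "\<dots> = (\<Sum>F\<in>P. \<Sum>e\<in>F. w (card e))"
  proof (subst sum.Union_disjoint)
    show "\<forall>F\<in>P. finite F" using F finE by (metis finite_subset)
    show "\<forall>A\<in>P. \<forall>B\<in>P. A \<noteq> B \<longrightarrow> A \<inter> B = {}"
      using P unfolding partition_on_def by (blast dest: disjointD)
  qed simp
  also have "\<dots> \<le> 0"
  proof (rule sum_nonpos)
    fix F assume "F \<in> P"
    note F = F[OF this]
    show "(\<Sum>e\<in>F. w (card e)) \<le> 0"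
    proof (rule neg)
      show "finite F" using F finE by (auto intro: finite_subset)
      show "0 < card e \<and> card e \<le> k" if "e \<in> F" for e
        using F that card_pos unfolding E_def by blast
      have "(\<Sum>e\<in>F. card e) = card (\<Union>F)"
      proof (rule card_Union_disjoint[symmetric])
        show "pairwise disjnt F" using F unfolding pairwise_def disjnt_def by (blast dest: disjointD)
        show "finite e" if "e \<in> F" for e
          using that F finite_subset[of e "{1..n}"] by blast
      qed
      then show "(\<Sum>e\<in>F. card e) = n" using F by simp
    qed
  qed
  finally show ?thesis .
qed

text \<open>The sum is positive if and only if the average size of the non-empty subsets with at most \<open>k\<close>
  elements is larger than \<open>Suc N / q\<close>.  It telescopes because \<open>i * (Suc N choose i)\<close> and
  \<open>Suc N choose i\<close> are both combinations of \<open>N choose (i - 1)\<close> and \<open>N choose i\<close>.\<close>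

lemma average_closed_form:
  "(\<Sum>i=1..k. (int q * int i - int (Suc N)) * int (Suc N choose i)) =
     int (Suc N) * ((int q - 2) * (\<Sum>j<k. int (N choose j)) - int (N choose k) + 1)"
proof (induction k)
  case (Suc k)
  have 1: "int (Suc k) * int (Suc N choose Suc k) = int (Suc N) * int (N choose k)"
    using Suc_times_binomial[of k N] by (metis of_nat_mult)
  have 2: "int (Suc N choose Suc k) = int (N choose k) + int (N choose Suc k)" by simp
  have "(int q * int (Suc k) - int (Suc N)) * int (Suc N choose Suc k) =
     int q * (int (Suc k) * int (Suc N choose Suc k)) - int (Suc N) * int (Suc N choose Suc k)"
    by (simp only: left_diff_distrib mult.assoc)
  also have "\<dots> = int (Suc N) * ((int q - 1) * int (N choose k) - int (N choose Suc k))"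
    unfolding 1 unfolding 2 by (simp add: algebra_simps)
  finally have step: "(int q * int (Suc k) - int (Suc N)) * int (Suc N choose Suc k) =
    int (Suc N) * ((int q - 1) * int (N choose k) - int (N choose Suc k))" .
  have "(\<Sum>i=1..Suc k. (int q * int i - int (Suc N)) * int (Suc N choose i)) =
     int (Suc N) * ((int q - 2) * (\<Sum>j<k. int (N choose j)) - int (N choose k) + 1) +
     (int q * int (Suc k) - int (Suc N)) * int (Suc N choose Suc k)"
    using Suc.IH by (simp only: sum.cl_ivl_Suc) simp
  also have "\<dots> = int (Suc N) * ((int q - 2) * (\<Sum>j<Suc k. int (N choose j)) - int (N choose Suc k) + 1)"
    unfolding step by (simp add: algebra_simps)
  finally show ?case .
qed simp

text \<open>The sum on the right is bounded below by comparing \<open>(N choose j) * g j\<close> for consecutive \<open>j\<close>, where \<open>g\<close>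
  is linear with \<open>g k = k * m\<close>.  The slope \<open>Suc N\<close> is large enough that \<open>g 0 < k * m\<close> and that the
  comparison holds; the first step down from \<open>j = k - 1\<close> is the critical one, and there the hypothesis
  on \<open>s\<close> is exactly what is needed.\<close>

lemma binomial_tail_bound:
  fixes N k q s :: nat
  assumes eq: "Suc N + s = q * k" and k: "0 < k" "2 * k < N + 3"
    and s: "int (Suc N) \<le> int s * (int N + 3 - 2 * int k)"
  shows "int (N choose k) < (int q - 2) * (\<Sum>j<k. int (N choose j)) + 1"
proof -
  define m where "m = int N + 3 - 2 * int k"
  define g where "g j = int k * m - (int k - int j) * int (Suc N)" for j
  have m: "0 < m" using k by (simp add: m_def)
  have step: "int (N choose Suc j) * g (Suc j) - int (N choose j) * g j
      \<le> (int q - 2) * int k * m * int (N choose j)" if j: "j < k" for j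
  proof -
    \<comment> \<open>in terms of \<open>i\<close> the difference of the two sides is \<open>(k - i) * (s * m) + n * (2 * i * i - i - k)\<close> with
      \<open>n = Suc N\<close>, which is at least \<open>n * (2 * i * (i - 1))\<close> because of \<open>n \<le> s * m\<close>\<close>
    define i where "i = int k - 1 - int j"
    have i: "0 \<le> i" "int j = int k - 1 - i" using j by (auto simp: i_def)
    have n: "int N = m - 3 + 2 * int k" by (simp add: m_def)
    have qk: "int q * int k = int N + 1 + int s"
      using eq by (metis of_nat_Suc of_nat_add of_nat_mult add.commute)
    have "int j < int k" using j by simp
    have absorb: "int (Suc j) * int (N choose Suc j) = (int N - int j) * int (N choose j)"
    proof -
      have "j \<le> N" using j k by linarith
      then show ?thesis using binomial_absorb[of N j] by (metis of_nat_diff of_nat_mult)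
    qed

    have "(int k - i) * (int N + 1) \<le> (int k - i) * (int s * m)"
      using s j by (intro mult_left_mono) (auto simp: m_def i_def)
    moreover have "0 \<le> (int N + 1) * (2 * i * (i - 1))"
      using i by (cases "i = 0") auto
    moreover have "int (Suc j) * ((int q - 2) * int k * m + g j) - (int N - int j) * g (Suc j) =
       (int k - i) * (int s * m) + (int N + 1) * (2 * i * i - i - int k)"
    proof -
      have qkm: "(int q - 2) * int k * m = (int N + 1 + int s - 2 * int k) * m"
        using qk by (simp add: left_diff_distrib)
      show ?thesis
        unfolding qkm g_def of_nat_Suc i(2) n by (simp add: algebra_simps)
    qed
    ultimately have "(int N - int j) * g (Suc j) \<le> int (Suc j) * ((int q - 2) * int k * m + g j)"
      by (simp add: algebra_simps)
    then have "int (N choose j) * ((int N - int j) * g (Suc j)) \<le>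
        int (N choose j) * (int (Suc j) * ((int q - 2) * int k * m + g j))"
      by (intro mult_left_mono) auto
    then have "int (Suc j) * (int (N choose Suc j) * g (Suc j)) \<le>
        int (Suc j) * (int (N choose j) * ((int q - 2) * int k * m + g j))"
      using absorb by (metis (no_types, opaque_lifting) mult.assoc mult.left_commute)
    then have "int (N choose Suc j) * g (Suc j) \<le> int (N choose j) * ((int q - 2) * int k * m + g j)"
      by (simp only: mult_le_cancel_left_pos of_nat_0_less_iff zero_less_Suc)
    then show ?thesis by (simp add: algebra_simps)
  qed
  have "int (N choose k) * g k - int (N choose 0) * g 0 =
      (\<Sum>j<k. int (N choose Suc j) * g (Suc j) - int (N choose j) * g j)"
    by (rule sum_lessThan_telescope[symmetric])
  also have "\<dots> \<le> (\<Sum>j<k. (int q - 2) * int k * m * int (N choose j))"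
    using step by (intro sum_mono) auto
  also have "\<dots> = (int q - 2) * int k * m * (\<Sum>j<k. int (N choose j))"
    by (simp add: sum_distrib_left)
  finally have "int k * m * int (N choose k) \<le>
      int k * m * ((int q - 2) * (\<Sum>j<k. int (N choose j)) + 1) - int k * int (Suc N)"
    by (simp add: g_def algebra_simps)
  also have "\<dots> < int k * m * ((int q - 2) * (\<Sum>j<k. int (N choose j)) + 1)"
    using k by simp
  finally show ?thesis using m k by (simp add: mult_less_cancel_left_pos)
qed

text \<open>For \<open>q = 3\<close> the inequality \<open>n \<le> s * (n + 2 - 2 * k)\<close> required by \<open>binomial_tail_bound\<close> is
  \<open>0 \<le> (s - 3) * (k - s)\<close>; for \<open>q = 4\<close> it follows from \<open>0 \<le> (s - 2) * (2 * k - s + 1)\<close>, and larger \<open>q\<close> only help.\<close>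

lemma average_too_large:
  fixes n k q s :: nat
  assumes eq: "n + s = q * k" and s: "2 \<le> s" "s < k" and q: "4 \<le> q \<or> q = 3 \<and> 3 \<le> s"
  shows "0 < (\<Sum>i=1..k. (int q * int i - int n) * int (n choose i))"
proof -
  have q3: "3 \<le> q" using q by auto
  then have "3 * k \<le> q * k" by simp
  then have n2: "2 * k < n" using eq s by linarith
  then obtain N where N: "n = Suc N" by (cases n) auto
  have n: "int n = int q * int k - int s"
    using eq by (metis add_diff_cancel_right' of_nat_add of_nat_mult)
  have "int n \<le> int s * (int n + 2 - 2 * int k)"
  proof (cases "q = 3")
    case True
    then have "0 \<le> (int s - 3) * (int k - int s)" using s q by simp
    then show ?thesis unfolding n True by (simp add: algebra_simps)
  next
    case False
    then have q4: "0 \<le> (int q - 4) * (int k * (int s - 1))" using q s by auto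
    have "0 \<le> (int s - 2) * (2 * int k - int s + 1)" using s by auto
    then show ?thesis using q4 unfolding n by (simp add: algebra_simps)
  qed
  then have "int (N choose k) < (int q - 2) * (\<Sum>j<k. int (N choose j)) + 1"
    using eq s n2 unfolding N by (intro binomial_tail_bound[where s = s]) (auto simp: algebra_simps)
  then have "0 < (int q - 2) * (\<Sum>j<k. int (N choose j)) - int (N choose k) + 1" by linarith
  then show ?thesis
    unfolding N average_closed_form by (intro mult_pos_pos) auto
qed

lemma truncated_weight_sum:
  fixes n q k' :: nat
  assumes "k' \<le> k"
  shows "(\<Sum>i=1..k. (if i \<le> k' then int q * int i - int n else 0) * int (n choose i)) =
    (\<Sum>i=1..k'. (int q * int i - int n) * int (n choose i))"
proof -
  have "(\<Sum>i=1..k'. (int q * int i - int n) * int (n choose i)) =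
     (\<Sum>i=1..k'. (if i \<le> k' then int q * int i - int n else 0) * int (n choose i))"
    by (intro sum.cong) auto
  also have "\<dots> = (\<Sum>i=1..k. (if i \<le> k' then int q * int i - int n else 0) * int (n choose i))"
    using assms by (intro sum.mono_neutral_left) auto
  finally show ?thesis by simp
qed

text \<open>The averaging argument for the edges of size at most \<open>k'\<close> alone: it suffices that within each
  factor those edges have average size at most \<open>n / q\<close>.\<close>

lemma average_obstruction:
  fixes n k k' q s :: nat
  assumes "n + s = q * k'" "2 \<le> s" "s < k'" "4 \<le> q \<or> q = 3 \<and> 3 \<le> s" "k' \<le> k"
    and small: "\<And>F :: nat set set. finite F \<Longrightarrow> (\<And>e. e \<in> F \<Longrightarrow> 0 < card e \<and> card e \<le> k) \<Longrightarrow>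
       (\<Sum>e\<in>F. card e) = n \<Longrightarrow>
       q * (\<Sum>e | e \<in> F \<and> card e \<le> k'. card e) \<le> n * card {e \<in> F. card e \<le> k'}"
  shows "\<not> one_factorable (complete_hypergraph_le n k)"
proof
  assume fac: "one_factorable (complete_hypergraph_le n k)"
  let ?w = "\<lambda>i. if i \<le> k' then int q * int i - int n else 0"
  have "(\<Sum>i=1..k. ?w i * int (n choose i)) \<le> 0"
  proof (rule weight_obstruction[OF fac])
    fix F :: "nat set set"
    assume F: "finite F" "\<And>e. e \<in> F \<Longrightarrow> 0 < card e \<and> card e \<le> k" "(\<Sum>e\<in>F. card e) = n"
    have "(\<Sum>e\<in>F. ?w (card e)) = (\<Sum>e | e \<in> F \<and> card e \<le> k'. int q * int (card e) - int n)"
      using F(1) by (simp add: sum.inter_filter)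
    also have "\<dots> = int q * (\<Sum>e | e \<in> F \<and> card e \<le> k'. int (card e)) - int n * int (card {e \<in> F. card e \<le> k'})"
      by (simp add: sum_subtractf sum_distrib_left)
    also have "\<dots> \<le> 0"
    proof -
      have "int (q * (\<Sum>e | e \<in> F \<and> card e \<le> k'. card e)) \<le> int (n * card {e \<in> F. card e \<le> k'})"
        using small[OF F] of_nat_le_iff by blast
      then show ?thesis by simp
    qed
    finally show "(\<Sum>e\<in>F. ?w (card e)) \<le> 0" .
  qed
  then show False
    using average_too_large[OF assms(1-4)] unfolding truncated_weight_sum[OF assms(5)] by linarith
qed

lemma not_factorable_residue:
  fixes n k q s :: nat
  assumes eq: "n + s = q * k" and s: "2 \<le> s" "s < k" and q: "4 \<le> q \<or> q = 3 \<and> 3 \<le> s"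
  shows "\<not> one_factorable (complete_hypergraph_le n k)"
proof (rule average_obstruction[OF assms order_refl])
  fix F :: "nat set set"
  assume F: "finite F" "\<And>e. e \<in> F \<Longrightarrow> 0 < card e \<and> card e \<le> k" "(\<Sum>e\<in>F. card e) = n"
  have "n \<le> card F * k"
    using sum_bounded_above[of F card k] F by auto
  \<comment> \<open>\<open>s < k\<close> excludes fewer than \<open>q\<close> edges\<close>
  then have "q * k < (card F + 1) * k" using eq s by simp
  then have "q < card F + 1" unfolding mult_less_cancel2 by simp
  then have "q \<le> card F" by simp
  moreover have "{e \<in> F. card e \<le> k} = F" "{e. e \<in> F \<and> card e \<le> k} = F" using F by auto
  ultimately show "q * (\<Sum>e | e \<in> F \<and> card e \<le> k. card e) \<le> n * card {e \<in> F. card e \<le> k}"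
    using F(3) by (simp add: mult.commute)
qed

text \<open>A factor that contains an edge of size below \<open>k\<close> has at least \<open>q + 1\<close> edges, hence average
  edge size at most \<open>n / (q + 1)\<close>.  Leaving out its \<open>k\<close>-sets, which are larger, lowers the average.\<close>

lemma not_factorable_multiple:
  fixes n k q :: nat
  assumes n: "n = q * k" and q: "3 \<le> q" "q + 3 \<le> k"
  shows "\<not> one_factorable (complete_hypergraph_le n k)"
proof (rule average_obstruction)
  show "n + (k - 1 - q) = (q + 1) * (k - 1)"
    using q n by (cases k) (auto simp: algebra_simps)
  show "2 \<le> k - 1 - q" "k - 1 - q < k - 1" "4 \<le> q + 1 \<or> q + 1 = 3 \<and> 3 \<le> k - 1 - q" "k - 1 \<le> k"
    using q by auto
  fix F :: "nat set set"
  assume F: "finite F" "\<And>e. e \<in> F \<Longrightarrow> 0 < card e \<and> card e \<le> k" "(\<Sum>e\<in>F. card e) = n"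
  let ?A = "{e. e \<in> F \<and> card e \<le> k - 1}"
  let ?Z = "{e. e \<in> F \<and> card e = k}"
  define Y where "Y = (\<Sum>e\<in>?A. card e)"
  define y where "y = card ?A"
  define z where "z = card ?Z"
  have split: "F = ?A \<union> ?Z" "?A \<inter> ?Z = {}" using F(2) q by (force, auto)
  have "n = Y + z * k"
    using F(1,3) sum.union_disjoint[of ?A ?Z card] split by (simp add: Y_def z_def)
  have "Y \<le> y * (k - 1)"
    using sum_bounded_above[of ?A card "k - 1"] by (simp add: Y_def y_def)
  show "(q + 1) * (\<Sum>e\<in>?A. card e) \<le> n * card ?A"
  proof (cases "y = 0")
    case True
    then have "Y = 0" using \<open>Y \<le> y * (k - 1)\<close> by simp
    then show ?thesis by (simp add: Y_def)
  next
    case False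
    then have "y * (k - 1) < y * k" using q by simp
    then have "q * k < (y + z) * k"
      using \<open>n = Y + z * k\<close> \<open>Y \<le> y * (k - 1)\<close> n by (simp add: algebra_simps)
    then have "q < y + z" unfolding mult_less_cancel2 by simp
    then have "q + 1 \<le> y + z" by simp
    then have "n * (q + 1) \<le> n * y + n * z" by (metis distrib_left mult_le_mono2)
    moreover have "(q + 1) * Y + (q + 1) * (z * k) = n * (q + 1)"
      using \<open>n = Y + z * k\<close> by (simp add: algebra_simps)
    moreover have "n * z \<le> (q + 1) * (z * k)" by (simp add: n algebra_simps)
    ultimately have "(q + 1) * Y \<le> n * y" by linarith
    then show ?thesis by (simp add: Y_def y_def)
  qed
qed

text \<open>A factor that contains an edge of size at most \<open>k - 2\<close> has at least \<open>q + 1\<close> edges, hence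
  average edge size at most \<open>n / (q + 1)\<close>.  Leaving out the edges of size \<open>k\<close> and \<open>k - 1\<close>, which are at
  least as large, lowers the average.\<close>

lemma not_factorable_pred_multiple:
  fixes n k q :: nat
  assumes n: "n + 1 = q * k" and q: "3 \<le> q" "2 * q + 3 \<le> k"
  shows "\<not> one_factorable (complete_hypergraph_le n k)"
proof (rule average_obstruction)
  show "n + (k - 1 - 2 * q) = (q + 1) * (k - 2)"
  proof -
    obtain r where r: "k = 2 * q + 3 + r" using q le_Suc_ex by blast
    show ?thesis using n unfolding r by (simp add: algebra_simps)
  qed
  show "2 \<le> k - 1 - 2 * q" "k - 1 - 2 * q < k - 2"
    "4 \<le> q + 1 \<or> q + 1 = 3 \<and> 3 \<le> k - 1 - 2 * q" "k - 2 \<le> k"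
    using q by auto
  fix F :: "nat set set"
  assume F: "finite F" "\<And>e. e \<in> F \<Longrightarrow> 0 < card e \<and> card e \<le> k" "(\<Sum>e\<in>F. card e) = n"
  let ?A = "{e. e \<in> F \<and> card e \<le> k - 2}"
  let ?U = "{e. e \<in> F \<and> card e = k - 1}"
  let ?Z = "{e. e \<in> F \<and> card e = k}"
  define Y where "Y = (\<Sum>e\<in>?A. card e)"
  define y where "y = card ?A"
  define u where "u = card ?U"
  define z where "z = card ?Z"
  have split: "F = ?A \<union> (?U \<union> ?Z)" "?A \<inter> (?U \<union> ?Z) = {}" "?U \<inter> ?Z = {}"
    using F(2) q by (force, auto)
  have neq: "n = Y + (u * (k - 1) + z * k)"
    using F(1,3) sum.union_disjoint[of ?A "?U \<union> ?Z" card] sum.union_disjoint[of ?U ?Z card] split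
    by (simp add: Y_def u_def z_def)
  have Y: "Y \<le> y * (k - 2)"
    using sum_bounded_above[of ?A card "k - 2"] by (simp add: Y_def y_def)
  show "(q + 1) * (\<Sum>e\<in>?A. card e) \<le> n * card ?A"
  proof (cases "y = 0")
    case True
    then have "Y = 0" using Y by simp
    then show ?thesis by (simp add: Y_def)
  next
    case False
    \<comment> \<open>one edge of size at most \<open>k - 2\<close> already makes \<open>q\<close> edges too few for \<open>q * k - 1\<close> vertices\<close>
    have "y * (k - 2) + 2 * y = y * k" using q by (simp add: algebra_simps flip: distrib_left)
    moreover have "u * (k - 1) \<le> u * k" by simp
    ultimately have "q * k < (y + u + z) * k"
      using neq Y n False by (simp add: algebra_simps)
    then have "q < y + u + z" unfolding mult_less_cancel2 by simp
    then have "q + 1 \<le> y + (u + z)" by simp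
    then have "n * (q + 1) \<le> n * y + n * (u + z)" by (metis distrib_left mult_le_mono2)
    moreover have "(q + 1) * Y + (q + 1) * (u * (k - 1) + z * k) = n * (q + 1)"
      using neq by (simp add: algebra_simps)
    moreover have "n * (u + z) \<le> (q + 1) * (u * (k - 1) + z * k)"
    proof -
      have "n \<le> (q + 1) * (k - 1)" using n q by (cases k) (auto simp: algebra_simps)
      then have "n * (u + z) \<le> (q + 1) * (k - 1) * (u + z)" by (rule mult_right_mono) simp
      also have "\<dots> = (q + 1) * (u * (k - 1) + z * (k - 1))"
        by (simp only: distrib_left mult.assoc mult.commute[of "k - 1"])
      also have "\<dots> \<le> (q + 1) * (u * (k - 1) + z * k)" by (intro mult_left_mono add_left_mono) auto
      finally show ?thesis .
    qed
    ultimately have "(q + 1) * Y \<le> n * y" by linarith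
    then show ?thesis by (simp add: Y_def y_def)
  qed
qed

text \<open>For \<open>q = 3\<close> and \<open>s = 2\<close> the inequality required by \<open>binomial_tail_bound\<close> fails.  Weights adapted to the
  possible factors replace the average: a factor contains at most two \<open>k\<close>-sets.  If there are two of
  them, the remaining \<open>k - 2\<close> vertices form either a single edge, of weight \<open>-4\<close>, or at least two edges
  of weight at most \<open>-2\<close>; if there is one, at least two other edges remain, of weight at most \<open>-1\<close>.\<close>

lemma not_factorable_3k_minus_2:
  fixes n k :: nat
  assumes n: "n + 2 = 3 * k" and k: "3 \<le> k"
  shows "\<not> one_factorable (complete_hypergraph_le n k)"
proof
  assume fac: "one_factorable (complete_hypergraph_le n k)"
  define W where "W i = (if i = k then 2 else if i = k - 1 then - 1 else if i = k - 2 then - 4 else - 2 :: int)" for i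
  have "(\<Sum>i=1..k. W i * int (n choose i)) \<le> 0"
  proof (rule weight_obstruction[OF fac])
    fix F :: "nat set set"
    assume F: "finite F" "\<And>e. e \<in> F \<Longrightarrow> 0 < card e \<and> card e \<le> k" "(\<Sum>e\<in>F. card e) = n"
    let ?A = "{e. e \<in> F \<and> card e < k}"
    let ?Z = "{e. e \<in> F \<and> card e = k}"
    define z where "z = card ?Z"
    have split: "F = ?A \<union> ?Z" "?A \<inter> ?Z = {}" using F(2) by (force, auto)
    have fin: "finite ?A" "finite ?Z" using F(1) by auto
    have size: "(\<Sum>e\<in>?A. card e) + z * k = n"
      using F(1,3) sum.union_disjoint[of ?A ?Z card] split fin by (simp add: z_def)
    have sumW: "(\<Sum>e\<in>F. W (card e)) = (\<Sum>e\<in>?A. W (card e)) + 2 * int z"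
    proof -
      have "(\<Sum>e\<in>F. W (card e)) = (\<Sum>e\<in>?A. W (card e)) + (\<Sum>e\<in>?Z. W (card e))"
        by (subst split(1), rule sum.union_disjoint[OF fin split(2)])
      then show ?thesis by (simp add: W_def z_def)
    qed
    have bound: "(\<Sum>e\<in>?A. W (card e)) \<le> int (card ?A) * c" if "\<And>e. e \<in> ?A \<Longrightarrow> W (card e) \<le> c" for c
      using sum_bounded_above[of ?A "\<lambda>e. W (card e)" c] that by blast
    have "z * k < 3 * k" using size n k by linarith
    then have "z = 0 \<or> z = 1 \<or> z = 2" by auto
    then show "(\<Sum>e\<in>F. W (card e)) \<le> 0"
    proof (elim disjE)
      assume "z = 0"
      then show ?thesis using bound[of 0] sumW by (auto simp: W_def)
    next
      assume z: "z = 1"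
      have "card e \<le> k - 1" if "e \<in> ?A" for e using that by auto
      then have "(\<Sum>e\<in>?A. card e) \<le> of_nat (card ?A) * (k - 1)" by (rule sum_bounded_above)
      moreover have "(\<Sum>e\<in>?A. card e) = 2 * (k - 1)" using size n z by simp
      ultimately have "2 * (k - 1) \<le> card ?A * (k - 1)" by simp
      then have "2 \<le> card ?A" unfolding mult_le_cancel2 using k by simp
      moreover have "(\<Sum>e\<in>?A. W (card e)) \<le> int (card ?A) * (- 1)"
        by (rule bound) (auto simp: W_def)
      ultimately show ?thesis using sumW z by simp
    next
      assume z: "z = 2"
      then have sz: "(\<Sum>e\<in>?A. card e) = k - 2" using size n by simp
      have le: "card e \<le> k - 2" if "e \<in> ?A" for e
        using member_le_sum[of e ?A card] fin that sz by simp
      show ?thesis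
      proof (cases "card ?A \<ge> 2")
        case True
        have "(\<Sum>e\<in>?A. W (card e)) \<le> int (card ?A) * (- 2)"
        proof (rule bound)
          fix e assume "e \<in> ?A"
          then show "W (card e) \<le> - 2" using le[of e] k by (auto simp: W_def)
        qed
        then show ?thesis using True sumW z by simp
      next
        case False
        moreover have "card ?A \<noteq> 0" using sz k fin(1) by (metis card_0_eq diff_is_0_eq not_less_eq_eq numeral_2_eq_2 numeral_3_eq_3 sum.empty)
        ultimately have "card ?A = 1" by linarith
        then obtain e where e: "?A = {e}" by (metis card_1_singletonE)
        have "k - 2 \<noteq> k" "k - 2 \<noteq> k - 1" using k by linarith+
        then have "W (card e) = - 4" using sz e by (simp add: W_def)
        then show ?thesis using sumW z e by simp
      qed
    qed
  qed
  moreover have "(\<Sum>i=1..k. W i * int (n choose i)) =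
     2 * int (n choose k) - int (n choose (k - 1)) - 4 * int (n choose (k - 2)) -
     2 * (\<Sum>i=1..k-3. int (n choose i))"
  proof -
    obtain r where "k = 3 + r" using le_Suc_ex[OF k] by blast
    then have r: "k = Suc (Suc (Suc r))" by simp
    have "(\<Sum>i=1..r. W i * int (n choose i)) = - 2 * (\<Sum>i=1..r. int (n choose i))"
      unfolding sum_distrib_left by (intro sum.cong) (auto simp: W_def r)
    then show ?thesis unfolding r by (simp add: W_def r)
  qed
  moreover have "(\<Sum>i=1..k-3. n choose i) \<le> 2 * (n choose (k - 3))"
  proof -
    have "(\<Sum>i=1..k-3. n choose i) \<le> (\<Sum>i\<le>k-3. n choose i)" by (rule sum_mono2) auto
    also have "\<dots> \<le> 2 * (n choose (k - 3))" using n by (intro sum_binomial_le_double) simp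
    finally show ?thesis .
  qed
  then have "(\<Sum>i=1..k-3. int (n choose i)) \<le> 2 * int (n choose (k - 3))"
    by (metis of_nat_le_iff of_nat_mult of_nat_numeral of_nat_sum)
  moreover have "0 < 2 * int (n choose k) - int (n choose (k - 1)) - 4 * int (n choose (k - 2)) -
     4 * int (n choose (k - 3))"
  proof -
    obtain r where "k = 3 + r" using le_Suc_ex[OF k] by blast
    then have r: "k = Suc (Suc (Suc r))" by simp
    have nr: "n = 3 * r + 7" using n r by simp
    define c0 c1 c2 c3 where "c0 = real (n choose k)" "c1 = real (n choose (k - 1))"
      "c2 = real (n choose (k - 2))" "c3 = real (n choose (k - 3))"
    have "(2 * r + 5) * (n choose (k - 1)) = (r + 3) * (n choose k)"
      using binomial_absorb[of n "r + 2"] by (simp add: r nr algebra_simps)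
    then have e0: "real (r + 3) * c0 = real (2 * r + 5) * c1"
      unfolding c0_c1_c2_c3_def by (simp only: of_nat_mult[symmetric])
    have "(2 * r + 6) * (n choose (k - 2)) = (r + 2) * (n choose (k - 1))"
      using binomial_absorb[of n "r + 1"] by (simp add: r nr algebra_simps)
    then have e1: "real (r + 2) * c1 = real (2 * r + 6) * c2"
      unfolding c0_c1_c2_c3_def by (simp only: of_nat_mult[symmetric])
    have "(2 * r + 7) * (n choose (k - 3)) = (r + 1) * (n choose (k - 2))"
      using binomial_absorb[of n "r"] by (simp add: r nr algebra_simps)
    then have e2: "real (r + 1) * c2 = real (2 * r + 7) * c3"
      unfolding c0_c1_c2_c3_def by (simp only: of_nat_mult[symmetric])
    have c3: "0 < c3" unfolding c0_c1_c2_c3_def using nr r by simp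
    define x where "x = real r"
    have x: "0 \<le> x" "x + 1 \<noteq> 0" "x + 2 \<noteq> 0" "x + 3 \<noteq> 0" by (auto simp: x_def)
    have c2: "c2 = (2 * x + 7) / (x + 1) * c3" using e2 x by (simp add: field_simps x_def)
    have c1: "c1 = (2 * x + 6) / (x + 2) * c2" using e1 x by (simp add: field_simps x_def)
    have c0: "c0 = (2 * x + 5) / (x + 3) * c1" using e0 x by (simp add: field_simps x_def)
    have "2 * c0 - c1 - 4 * c2 - 4 * c3 = (14 * x + 34) / ((x + 1) * (x + 2)) * c3"
      unfolding c0 c1 c2 using x by (simp add: divide_simps) algebra
    then have "2 * c0 - c1 - 4 * c2 - 4 * c3 > 0" using x c3 by simp
    then show ?thesis unfolding c0_c1_c2_c3_def by linarith
  qed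
  ultimately show False by linarith
qed

theorem factorable_imp_conditions:
  fixes n k :: nat
  assumes fac: "one_factorable (complete_hypergraph_le n k)" and k: "0 < k" "2 * k < n"
  shows "(\<exists>q. n = q * k \<and> k \<le> q + 2) \<or> (\<exists>q. n + 1 = q * k \<and> k \<le> 2 * q + 2)"
proof -
  define q where "q = (n + k - 1) div k"
  define s where "s = q * k - n"
  have qk: "q * k \<le> n + k - 1" "n + k - 1 < (q + 1) * k"
    unfolding q_def using k by (simp_all add: dividend_less_div_times add.commute)
  then have s: "n + s = q * k" "s < k" using k by (auto simp: s_def)
  then have "2 * k < q * k" using k by linarith
  then have q: "3 \<le> q" by simp
  consider "s = 0" | "s = 1" | "2 \<le> s" by linarith
  then show ?thesis
  proof cases
    case 1
    then have "k \<le> q + 2" using not_factorable_multiple[of n q k] fac s q by (cases "q + 3 \<le> k") auto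
    then show ?thesis using s 1 by auto
  next
    case 2
    then have "k \<le> 2 * q + 2" using not_factorable_pred_multiple[of n q k] fac s q by (cases "2 * q + 3 \<le> k") auto
    then show ?thesis using s 2 by auto
  next
    case 3
    show ?thesis
    proof (cases "q = 3 \<and> s = 2")
      case True
      then show ?thesis using not_factorable_3k_minus_2[of n k] fac s by auto
    next
      case False
      then have "4 \<le> q \<or> q = 3 \<and> 3 \<le> s" using q 3 by linarith
      then show ?thesis using not_factorable_residue[OF s(1) 3 s(2)] fac by blast
    qed
  qed
qed

section \<open>From numerical to actual factorizations\<close>

text \<open>The number \<open>N\<close> of parts is recorded because it determines the sum of \<open>M\<close>, which saves counting one of the sizes in \<open>splits_odd\<close>.\<close>

definition splits :: "nat \<Rightarrow> nat \<Rightarrow> nat multiset \<Rightarrow> bool" where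
  "splits n N M \<longleftrightarrow> (\<exists>\<F>. size \<F> = N \<and> (\<forall>T\<in>#\<F>. \<Sum>\<^sub># T = n) \<and> \<Sum>\<^sub># \<F> = M)"

lemma replicate_mset_add: "replicate_mset (a + b) x = replicate_mset a x + replicate_mset b x"
  by (induction a) auto

lemma splits_add:
  assumes "splits n N M" "splits n N' M'"
  shows "splits n (N + N') (M + M')"
proof -
  obtain F F' where "size F = N" "\<forall>T\<in>#F. \<Sum>\<^sub># T = n" "\<Sum>\<^sub># F = M"
    "size F' = N'" "\<forall>T\<in>#F'. \<Sum>\<^sub># T = n" "\<Sum>\<^sub># F' = M'"
    using assms unfolding splits_def by blast
  then show ?thesis unfolding splits_def by (intro exI[of _ "F + F'"]) auto
qed

lemma splits_repeat:
  assumes "c = 0 \<or> \<Sum>\<^sub># T = n"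
  shows "splits n c (repeat_mset c T)"
proof -
  have "\<Sum>\<^sub># (replicate_mset c T) = repeat_mset c T" by (induction c) auto
  then show ?thesis using assms unfolding splits_def
    by (intro exI[of _ "replicate_mset c T"]) auto
qed

lemma splits_sum:
  assumes "finite A" "\<And>i. i \<in> A \<Longrightarrow> splits n (c i) (M i)"
  shows "splits n (\<Sum>i\<in>A. c i) (\<Sum>i\<in>A. M i)"
  using assms
proof (induction A rule: finite_induct)
  case empty
  show ?case unfolding splits_def by (intro exI[of _ "{#}"]) auto
qed (simp add: splits_add)

lemma sum_mset_Union: "\<Sum>\<^sub># (\<Sum>\<^sub># \<F>) = (\<Sum>T\<in>#\<F>. \<Sum>\<^sub># T)" for \<F> :: "nat multiset multiset"
  by (induction \<F>) auto

lemma splits_total: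
  assumes "splits n N M"
  shows "\<Sum>\<^sub># M = n * N"
proof -
  obtain F where F: "size F = N" "\<forall>T\<in>#F. \<Sum>\<^sub># T = n" "\<Sum>\<^sub># F = M"
    using assms unfolding splits_def by blast
  have "(\<Sum>T\<in>#F. \<Sum>\<^sub># T) = (\<Sum>T\<in>#F. n)" using F(2) by (intro arg_cong[of _ _ sum_mset] image_mset_cong) auto
  then show ?thesis using F(1,3) sum_mset_Union[of F] by simp
qed

lemma sum_count_times:
  fixes M :: "nat multiset"
  assumes "finite I" "set_mset M \<subseteq> I"
  shows "(\<Sum>i\<in>I. count M i * i) = \<Sum>\<^sub># M"
  using assms(2)
proof (induction M)
  case (add x M)
  have "(\<Sum>i\<in>I. count (add_mset x M) i * i) = (\<Sum>i\<in>I. count M i * i + (if i = x then i else 0))"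
    by (intro sum.cong) auto
  also have "\<dots> = (\<Sum>i\<in>I. count M i * i) + (\<Sum>i\<in>I. if i = x then i else 0)"
    by (rule sum.distrib)
  also have "\<dots> = \<Sum>\<^sub># M + x" using add assms(1) by (simp add: sum.delta)
  finally show ?case by simp
qed simp

lemma count_sum_mset_list: "count (\<Sum>\<^sub># (mset Fs)) i = (\<Sum>j<length Fs. count (Fs ! j) i)"
proof -
  have "count (\<Sum>\<^sub># (mset Fs)) i = sum_list (map (\<lambda>F. count F i) Fs)"
    by (induction Fs) auto
  then show ?thesis by (simp add: sum_list_sum_nth atLeast0LessThan)
qed

lemma count_sum_replicate:
  assumes "finite I"
  shows "count (\<Sum>j\<in>I. replicate_mset (c j) j) i = (if i \<in> I then c i else 0)"
proof -
  have "count (\<Sum>j\<in>I. replicate_mset (c j) j) i = (\<Sum>j\<in>I. count (replicate_mset (c j) j) i)"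
    by (simp add: count_sum)
  also have "\<dots> = (\<Sum>j\<in>I. if j = i then c j else 0)" by (intro sum.cong) auto
  also have "\<dots> = (if i \<in> I then c i else 0)" using assms by (simp add: sum.delta)
  finally show ?thesis .
qed

text \<open>Baranyai's theorem for sets \<open>I\<close> of admissible sizes.  The map \<open>\<phi>\<close> transports the subsets of \<open>{..<m}\<close> to
  the edges of \<open>H\<close>.  It need not preserve sizes: a point of \<open>{..<m}\<close> outside the range of \<open>\<tau>\<close> may be
  forgotten.  The slots are triples of a factor, a size and a running number.\<close>

theorem one_factorable_of_splits:
  fixes H :: "'a hypergraph" and \<phi> :: "nat set \<Rightarrow> 'a set" and \<tau> :: "'a \<Rightarrow> nat"
  assumes sp: "splits m N (\<Sum>i\<in>I. replicate_mset (m choose i) i)"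
    and I: "finite I" and m: "0 < m"
    and \<phi>: "bij_betw \<phi> {T. T \<subseteq> {..<m} \<and> card T \<in> I} (edges H)"
    and \<tau>: "\<And>v. v \<in> verts H \<Longrightarrow> \<tau> v < m"
    and mem: "\<And>T v. T \<subseteq> {..<m} \<Longrightarrow> card T \<in> I \<Longrightarrow> v \<in> verts H \<Longrightarrow> v \<in> \<phi> T \<longleftrightarrow> \<tau> v \<in> T"
  shows "one_factorable H"
proof -
  obtain \<F> where F: "\<forall>T\<in>#\<F>. \<Sum>\<^sub># T = m" "\<Sum>\<^sub># \<F> = (\<Sum>i\<in>I. replicate_mset (m choose i) i)"
    using sp unfolding splits_def by blast
  obtain Fs where Fs: "\<F> = mset Fs" using ex_mset[of \<F>] by blast
  let ?J = "{..<length Fs}"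
  define X where "X = Sigma ?J (\<lambda>j. Sigma I (\<lambda>i. {..<count (Fs ! j) i}))"
  let ?sz = "\<lambda>x. fst (snd x)"
  have cnt: "(\<Sum>j\<in>?J. count (Fs ! j) i) = (if i \<in> I then m choose i else 0)" for i
    using F(2) count_sum_mset_list[of Fs i] count_sum_replicate[OF I] by (simp add: Fs)
  have finX: "finite X" unfolding X_def using I by auto
  have owner: "{x. x \<in> X \<and> fst x = j} = Pair j ` (Sigma I (\<lambda>i. {..<count (Fs ! j) i}))" if "j \<in> ?J" for j
    using that unfolding X_def by force
  have "\<exists>C. bij_betw C X {T. T \<subseteq> {..<m} \<and> card T \<in> I} \<and>
     (\<forall>j\<in>?J. \<forall>v<m. \<exists>!x. x \<in> X \<and> fst x = j \<and> v \<in> C x)"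
  proof (rule baranyai_slots[where sz = ?sz])
    show "fst ` X \<subseteq> ?J" "?sz ` X \<subseteq> I" unfolding X_def by auto
    show "finite X" by (rule finX)
    show "(\<Sum>x | x \<in> X \<and> fst x = j. ?sz x) = m" if j: "j \<in> ?J" for j
    proof -
      have "set_mset (Fs ! j) \<subseteq> I"
      proof
        fix i assume i: "i \<in># Fs ! j"
        show "i \<in> I"
        proof (rule ccontr)
          assume "i \<notin> I"
          then have "(\<Sum>j\<in>?J. count (Fs ! j) i) = 0" using cnt[of i] by simp
          then have "count (Fs ! j) i = 0" using j by simp
          then show False using i by (simp add: count_eq_zero_iff)
        qed
      qed
      have "(\<Sum>x | x \<in> X \<and> fst x = j. ?sz x) = (\<Sum>p\<in>Sigma I (\<lambda>i. {..<count (Fs ! j) i}). fst p)"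
        unfolding owner[OF j] by (subst sum.reindex) (auto simp: inj_on_def)
      also have "\<dots> = (\<Sum>i\<in>I. \<Sum>t<count (Fs ! j) i. i)"
        using I by (subst sum.Sigma) (auto simp: case_prod_beta)
      also have "\<dots> = \<Sum>\<^sub># (Fs ! j)" using sum_count_times[OF I \<open>set_mset (Fs ! j) \<subseteq> I\<close>] by simp
      also have "\<dots> = m" using F(1) j by (simp add: Fs)
      finally show ?thesis .
    qed
    show "card {x \<in> X. ?sz x = i} = m choose i" if i: "i \<in> I" for i
    proof -
      have "{x \<in> X. ?sz x = i} = (\<lambda>(j, t). (j, i, t)) ` (Sigma ?J (\<lambda>j. {..<count (Fs ! j) i}))"
        unfolding X_def using i by force
      then have "card {x \<in> X. ?sz x = i} = card (Sigma ?J (\<lambda>j. {..<count (Fs ! j) i}))"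
        by (simp add: card_image inj_on_def)
      then show ?thesis using cnt[of i] i by simp
    qed
  qed simp
  then obtain C where C: "bij_betw C X {T. T \<subseteq> {..<m} \<and> card T \<in> I}"
    and uniq: "\<And>j v. j \<in> ?J \<Longrightarrow> v < m \<Longrightarrow> \<exists>!x. x \<in> X \<and> fst x = j \<and> v \<in> C x" by blast
  have CX: "C x \<subseteq> {..<m}" "card (C x) \<in> I" if "x \<in> X" for x
    using C that unfolding bij_betw_def by auto
  define e where "e = \<phi> \<circ> C"
  have e: "bij_betw e X (edges H)" unfolding e_def by (rule bij_betw_trans[OF C \<phi>])
  define slots where "slots j = {x \<in> X. fst x = j}" for j
  define P where "P = (\<lambda>j. e ` slots j) ` ?J"
  have slots_sub: "slots j \<subseteq> X" for j unfolding slots_def by blast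
  have "(\<Union>j\<in>?J. slots j) = X" unfolding slots_def X_def by auto
  have "partition_on (edges H) P"
  proof (rule partition_onI)
    have "\<Union>P = e ` (\<Union>j\<in>?J. slots j)" unfolding P_def by blast
    then show "\<Union>P = edges H"
      using e \<open>(\<Union>j\<in>?J. slots j) = X\<close> by (simp add: bij_betw_def)
    show "disjnt p p'" if "p \<in> P" "p' \<in> P" "p \<noteq> p'" for p p'
    proof -
      obtain j j' where j: "p = e ` slots j" "p' = e ` slots j'" using \<open>p \<in> P\<close> \<open>p' \<in> P\<close> unfolding P_def by blast
      have "slots j \<inter> slots j' = {}" using j \<open>p \<noteq> p'\<close> unfolding slots_def by blast
      then have "e ` slots j \<inter> e ` slots j' = {}"
        using e slots_sub inj_on_image_Int[of e X "slots j" "slots j'"] by (simp add: bij_betw_def)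
      then show ?thesis unfolding j disjnt_def .
    qed
    show "{} \<notin> P"
    proof
      assume "{} \<in> P"
      then obtain j where j: "j \<in> ?J" "slots j = {}" unfolding P_def by auto
      then show False using uniq[OF j(1) m] unfolding slots_def by blast
    qed
  qed
  moreover have "one_factor H F" if "F \<in> P" for F
  proof -
    obtain j where j: "j \<in> ?J" "F = e ` slots j" using \<open>F \<in> P\<close> unfolding P_def by blast
    have "\<exists>!a. a \<in> F \<and> v \<in> a" if v: "v \<in> verts H" for v
    proof -
      have iff: "v \<in> e x \<longleftrightarrow> \<tau> v \<in> C x" if "x \<in> X" for x
        using mem[OF CX[OF that] v] by (simp add: e_def)
      obtain x where x: "x \<in> slots j" "\<tau> v \<in> C x" "\<And>y. y \<in> slots j \<Longrightarrow> \<tau> v \<in> C y \<Longrightarrow> y = x"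
        using uniq[OF j(1) \<tau>[OF v]] unfolding slots_def by blast
      show ?thesis
      proof (rule ex1I[of _ "e x"])
        show "e x \<in> F \<and> v \<in> e x" using x iff slots_sub j(2) by blast
        fix a assume "a \<in> F \<and> v \<in> a"
        then obtain y where "y \<in> slots j" "a = e y" "v \<in> e y" unfolding j(2) by blast
        then show "a = e x" using x(3)[of y] iff[of y] slots_sub by blast
      qed
    qed
    moreover have "F \<subseteq> edges H" using e slots_sub unfolding j(2) bij_betw_def by blast
    ultimately show ?thesis unfolding one_factor_def by blast
  qed
  ultimately show ?thesis unfolding one_factorable_def by blast
qed

lemma factorable_of_splits_le:
  assumes "splits n N (\<Sum>i=1..k. replicate_mset (n choose i) i)" "0 < n"
  shows "one_factorable (complete_hypergraph_le n k)"
proof (rule one_factorable_of_splits[OF assms(1) _ assms(2), where \<phi> = "\<lambda>T. Suc ` T" and \<tau> = "\<lambda>v. v - 1"])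
  let ?H = "complete_hypergraph_le n k"
  show "bij_betw ((`) Suc) {T. T \<subseteq> {..<n} \<and> card T \<in> {1..k}} (edges ?H)"
    unfolding bij_betw_def
  proof
    show "inj_on ((`) Suc) {T. T \<subseteq> {..<n} \<and> card T \<in> {1..k}}"
      by (rule inj_onI) (simp add: inj_image_eq_iff)
    show "(`) Suc ` {T. T \<subseteq> {..<n} \<and> card T \<in> {1..k}} = edges ?H"
    proof (intro equalityI subsetI)
      fix e assume "e \<in> (`) Suc ` {T. T \<subseteq> {..<n} \<and> card T \<in> {1..k}}"
      then show "e \<in> edges ?H"
        by (auto simp: complete_hypergraph_le_def card_image)
    next
      fix e assume "e \<in> edges ?H"
      then have e: "e \<subseteq> {1..n}" "e \<noteq> {}" "card e \<le> k" by (auto simp: complete_hypergraph_le_def)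
      then have "finite e" using finite_subset by blast
      then have "1 \<le> card e" using e by (simp add: Suc_le_eq card_gt_0_iff)
      define T where "T = (\<lambda>v. v - 1) ` e"
      have "Suc ` T = e" using e(1) unfolding T_def by (force simp: image_image)
      moreover have "card T = card e"
        unfolding T_def
      proof (intro card_image inj_onI)
        fix x y assume "x \<in> e" "y \<in> e" "x - 1 = y - 1"
        moreover from this have "1 \<le> x" "1 \<le> y" using e(1) by auto
        ultimately show "x = y" by linarith
      qed
      moreover have "T \<subseteq> {..<n}" using e(1) unfolding T_def by force
      ultimately show "e \<in> (`) Suc ` {T. T \<subseteq> {..<n} \<and> card T \<in> {1..k}}"
        using e \<open>1 \<le> card e\<close> by (intro image_eqI[of _ _ T]) auto
    qed
  qed
  show "v - 1 < n" if "v \<in> verts ?H" for v using that by (auto simp: complete_hypergraph_le_def)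
  show "v \<in> Suc ` T \<longleftrightarrow> v - 1 \<in> T" if "v \<in> verts ?H" for T v
    using that by (cases v) (auto simp: complete_hypergraph_le_def)
qed simp

text \<open>The point \<open>0\<close> is the additional point: deleting it maps the non-empty subsets of \<open>{0..n}\<close> of even
  size at most \<open>2 * r\<close> bijectively to the non-empty subsets of \<open>{1..n}\<close> of size at most \<open>2 * r\<close>.\<close>

lemma factorable_of_splits_even:
  assumes sp: "splits (n + 1) N (\<Sum>a=1..r. replicate_mset ((n + 1) choose (2 * a)) (2 * a))"
  shows "one_factorable (complete_hypergraph_le n (2 * r))"
proof -
  let ?H = "complete_hypergraph_le n (2 * r)"
  let ?I = "(\<lambda>a. 2 * a) ` {1..r}"
  have I: "i \<in> ?I \<longleftrightarrow> even i \<and> 0 < i \<and> i \<le> 2 * r" for i :: nat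
    by (auto elim!: evenE)
  have "(\<Sum>i\<in>?I. replicate_mset ((n + 1) choose i) i) = (\<Sum>a=1..r. replicate_mset ((n + 1) choose (2 * a)) (2 * a))"
    by (subst sum.reindex) (auto simp: inj_on_def)
  then have sp': "splits (n + 1) N (\<Sum>i\<in>?I. replicate_mset ((n + 1) choose i) i)" using sp by simp
  show ?thesis
  proof (rule one_factorable_of_splits[OF sp', where \<phi> = "\<lambda>T. T - {0}" and \<tau> = "\<lambda>v. v"])
    let ?g = "\<lambda>e :: nat set. if even (card e) then e else insert 0 e"
    have fin: "finite T" if "T \<subseteq> {..<n + 1}" for T using that finite_subset by blast
    show "bij_betw (\<lambda>T. T - {0}) {T. T \<subseteq> {..<n + 1} \<and> card T \<in> ?I} (edges ?H)"
    proof (rule bij_betw_byWitness[where f' = ?g])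
      show "\<forall>T\<in>{T. T \<subseteq> {..<n + 1} \<and> card T \<in> ?I}. ?g (T - {0}) = T"
      proof
        fix T assume "T \<in> {T. T \<subseteq> {..<n + 1} \<and> card T \<in> ?I}"
        then have T: "finite T" "even (card T)" "0 < card T" using fin unfolding mem_Collect_eq I by auto
        show "?g (T - {0}) = T"
        proof (cases "0 \<in> T")
          case True
          then have "Suc (card (T - {0})) = card T" using T(1) by (intro card_Suc_Diff1)
          then have "odd (card (T - {0}))" using T(2) by presburger
          then show ?thesis using True by (simp add: insert_absorb)
        qed (use T in simp)
      qed
      have He: "e \<in> edges ?H \<longleftrightarrow> e \<subseteq> {1..n} \<and> e \<noteq> {} \<and> card e \<le> 2 * r" for e
        by (simp add: complete_hypergraph_le_def)
      show "\<forall>e\<in>edges ?H. ?g e - {0} = e"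
      proof
        fix e assume "e \<in> edges ?H"
        then have "0 \<notin> e" using He[of e] by auto
        then show "?g e - {0} = e" by auto
      qed
      show "(\<lambda>T. T - {0}) ` {T. T \<subseteq> {..<n + 1} \<and> card T \<in> ?I} \<subseteq> edges ?H"
      proof
        fix e assume "e \<in> (\<lambda>T. T - {0}) ` {T. T \<subseteq> {..<n + 1} \<and> card T \<in> ?I}"
        then obtain T where T: "e = T - {0}" "T \<subseteq> {..<n + 1}" "even (card T)" "0 < card T" "card T \<le> 2 * r"
          unfolding I by blast
        have "T \<noteq> {0}" using T(3) by auto
        then have "e \<noteq> {}" using T(1,4) by (auto simp: subset_singleton_iff)
        moreover have "card e \<le> card T" unfolding T(1) using fin[OF T(2)] by (intro card_mono) auto
        moreover have "e \<subseteq> {1..n}" using T(1,2) by (auto simp: Suc_le_eq less_Suc_eq_le)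
        ultimately show "e \<in> edges ?H" using T(5) unfolding He by simp
      qed
      show "?g ` edges ?H \<subseteq> {T. T \<subseteq> {..<n + 1} \<and> card T \<in> ?I}"
      proof
        fix T assume "T \<in> ?g ` edges ?H"
        then obtain e where "T = ?g e" "e \<in> edges ?H" by (rule imageE)
        then have e: "T = ?g e" "e \<subseteq> {1..n}" "e \<noteq> {}" "card e \<le> 2 * r" using He[of e] by auto
        have fe: "finite e" "0 \<notin> e" using e(2) finite_subset[of e "{1..n}"] by auto
        have "0 < card e" using e(3) fe by (simp add: card_gt_0_iff)
        have "card T = (if even (card e) then card e else Suc (card e))"
          using e(1) fe by simp
        moreover have "Suc (card e) \<le> 2 * r" if "odd (card e)"
          using e(4) that by (metis Suc_leI dvd_triv_left le_neq_implies_less)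
        ultimately have "card T \<le> 2 * r" "even (card T)" "0 < card T"
          using e(4) \<open>0 < card e\<close> by (cases "even (card e)"; simp)+
        moreover have "T \<subseteq> {..<n + 1}" using e(1,2) by auto
        ultimately show "T \<in> {T. T \<subseteq> {..<n + 1} \<and> card T \<in> ?I}" unfolding mem_Collect_eq I by simp
      qed
    qed
  qed (auto simp: complete_hypergraph_le_def)
qed

section \<open>Zero-sum groups\<close>

text \<open>Two of the \<open>k + 1\<close> initial segments of a list of \<open>k\<close> numbers have sums that are congruent
  modulo \<open>k\<close>; the segment between them is the required one.\<close>

lemma zero_sum_submultiset:
  fixes M :: "nat multiset"
  assumes "0 < k" "k \<le> size M"
  shows "\<exists>G. G \<subseteq># M \<and> G \<noteq> {#} \<and> size G \<le> k \<and> k dvd \<Sum>\<^sub># G"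
proof -
  obtain xs where xs: "mset xs = M" using ex_mset by blast
  have len: "k \<le> length xs" using assms(2) xs by (metis size_mset)
  define p where "p i = sum_list (take i xs) mod k" for i
  have "\<not> inj_on p {..k}"
  proof
    assume "inj_on p {..k}"
    then have "card {..k} \<le> card {..<k}"
      using assms(1) by (intro card_inj_on_le[of p]) (auto simp: p_def)
    then show False by simp
  qed
  then obtain i j where ij: "i < j" "j \<le> k" "p i = p j"
    unfolding inj_on_def by (metis atMost_iff linorder_neqE_nat)
  define ys where "ys = drop i (take j xs)"
  have tk: "take j xs = take i xs @ ys"
    unfolding ys_def using ij(1) append_take_drop_id[of i "take j xs"] by (simp add: min_def)
  have "sum_list (take i xs) \<le> sum_list (take j xs)" unfolding tk by simp
  then have "k dvd sum_list (take j xs) - sum_list (take i xs)"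
    using ij(3) mod_eq_dvd_iff_nat unfolding p_def by metis
  then have "k dvd \<Sum>\<^sub># (mset ys)" unfolding tk by (simp add: sum_mset_sum_list)
  moreover have "xs = take i xs @ ys @ drop j xs" using tk append_take_drop_id[of j xs] by (metis append.assoc)
  then have "mset ys \<subseteq># M" unfolding xs[symmetric]
    by (metis mset_append mset_subset_eq_add_left mset_subset_eq_add_right subset_mset.order_trans)
  moreover have "length ys = j - i" unfolding ys_def using ij len by simp
  then have "mset ys \<noteq> {#}" "size (mset ys) \<le> k" using ij by auto
  ultimately show ?thesis by blast
qed

lemma zero_sum_decomposition:
  fixes M :: "nat multiset"
  assumes "0 < k" "k dvd \<Sum>\<^sub># M"
  shows "\<exists>\<G>. \<Sum>\<^sub># \<G> = M \<and> (\<forall>G\<in>#\<G>. G \<noteq> {#} \<and> size G \<le> k \<and> k dvd \<Sum>\<^sub># G)"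
  using assms(2)
proof (induction "size M" arbitrary: M rule: less_induct)
  case less
  show ?case
  proof (cases "M = {#}")
    case True
    then show ?thesis by (intro exI[of _ "{#}"]) simp
  next
    case False
    show ?thesis
    proof (cases "size M \<le> k")
      case True
      then show ?thesis using False less.prems by (intro exI[of _ "{#M#}"]) simp
    next
      case nle: False
      then obtain G where G: "G \<subseteq># M" "G \<noteq> {#}" "size G \<le> k" "k dvd \<Sum>\<^sub># G"
        using zero_sum_submultiset[OF assms(1), of M] by auto
      have M: "M = G + (M - G)" using G(1) by simp
      have "0 < size G" using G(2) by (simp add: nonempty_has_size)
      moreover have "size M = size G + size (M - G)" using M by (metis size_union)
      ultimately have "size (M - G) < size M" by linarith
      moreover have "k dvd \<Sum>\<^sub># (M - G)"
        using less.prems G(4) M by (metis dvd_add_right_iff sum_mset.union)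
      ultimately obtain \<G> where "\<Sum>\<^sub># \<G> = M - G" "\<forall>G\<in>#\<G>. G \<noteq> {#} \<and> size G \<le> k \<and> k dvd \<Sum>\<^sub># G"
        using less.hyps by blast
      then show ?thesis using G M by (intro exI[of _ "add_mset G \<G>"]) auto
    qed
  qed
qed

lemma sum_mset_le_size:
  fixes M :: "nat multiset"
  assumes "\<And>x. x \<in># M \<Longrightarrow> x \<le> q"
  shows "\<Sum>\<^sub># M \<le> size M * q"
  using assms by (induction M) (auto intro: add_mono)

text \<open>Groups of at most \<open>k\<close> elements that are at most \<open>q\<close> have sum at most \<open>q * k\<close>.  A group with sum divisible by
  \<open>k\<close> has at least two elements and therefore needs at most \<open>q - 1\<close> copies of \<open>k\<close>, so the hypothesis on \<open>Z\<close>
  provides enough of them.  The copies of \<open>k\<close> that are left over form groups on their own.\<close>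

lemma splits_by_padding:
  fixes M :: "nat multiset"
  assumes small: "\<And>x. x \<in># M \<Longrightarrow> 0 < x \<and> x < k \<and> x \<le> q"
    and k: "0 < k" and q: "0 < q"
    and dvd: "q * k dvd \<Sum>\<^sub># M + Z * k" and Z: "(q - 1) * size M \<le> 2 * Z"
  shows "\<exists>N. splits (q * k) N (M + replicate_mset Z k)"
proof -
  have "k dvd \<Sum>\<^sub># M + Z * k" using dvd by (rule dvd_mult_right)
  then have "k dvd \<Sum>\<^sub># M" by (simp add: dvd_add_left_iff)
  then obtain \<G> where G: "\<Sum>\<^sub># \<G> = M" and G': "\<And>G. G \<in># \<G> \<Longrightarrow> G \<noteq> {#} \<and> size G \<le> k \<and> k dvd \<Sum>\<^sub># G"
    using zero_sum_decomposition[OF k] by blast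
  define pad where "pad G = q - \<Sum>\<^sub># G div k" for G
  have GM: "x \<in># M" if "G \<in># \<G>" "x \<in># G" for G x using that G by auto
  have gp: "\<Sum>\<^sub># G + pad G * k = q * k \<and> pad G \<le> q - 1 \<and> 2 \<le> size G" if g: "G \<in># \<G>" for G
  proof -
    have "\<Sum>\<^sub># G \<le> size G * q" using GM[OF g] small by (intro sum_mset_le_size) blast
    also have "\<dots> \<le> k * q" using G'[OF g] by simp
    finally have le: "\<Sum>\<^sub># G \<le> q * k" by (simp add: mult.commute)
    obtain t where t: "\<Sum>\<^sub># G = k * t" using G'[OF g] by (auto elim: dvdE)
    obtain x where x: "x \<in># G" using G'[OF g] by (auto simp: multiset_nonemptyE)
    then obtain G1 where G1: "G = add_mset x G1" by (metis mset_add)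
    have x': "0 < x" "x < k" using small[OF GM[OF g x]] by auto
    have "0 < \<Sum>\<^sub># G" using G1 x' by simp
    then have t1: "1 \<le> t" using t by (cases t) auto
    have "t \<le> q" using le t k by (simp add: mult.commute)
    moreover have "\<Sum>\<^sub># G div k = t" using t k by simp
    ultimately have "\<Sum>\<^sub># G + pad G * k = q * k" "pad G \<le> q - 1"
      using t t1 distrib_left[of k t "q - t"] unfolding pad_def by (simp_all add: mult.commute)
    moreover have "G1 \<noteq> {#}"
    proof
      assume "G1 = {#}"
      then have "k dvd x" using G'[OF g] G1 by simp
      then show False using x' by (auto dest: dvd_imp_le)
    qed
    then have "2 \<le> size G" using G1 by (cases "size G1") auto
    ultimately show ?thesis by blast
  qed
  define z where "z = (\<Sum>G\<in>#\<G>. pad G)"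
  have sp: "splits (q * k) (size \<G>) (M + replicate_mset z k)"
    unfolding splits_def
  proof (intro exI[of _ "image_mset (\<lambda>G. G + replicate_mset (pad G) k) \<G>"] conjI)
    show "\<Sum>\<^sub># (image_mset (\<lambda>G. G + replicate_mset (pad G) k) \<G>) = M + replicate_mset z k"
      unfolding G[symmetric] z_def by (induction \<G>) (auto simp: replicate_mset_add)
  qed (use gp in auto)
  have "z \<le> size (image_mset pad \<G>) * (q - 1)"
    unfolding z_def using gp by (intro sum_mset_le_size) auto
  moreover have "(\<Sum>G\<in>#\<G>. 2) \<le> (\<Sum>G\<in>#\<G>. size G)"
    using gp by (intro sum_mset_mono) blast
  then have "2 * size \<G> \<le> size M" unfolding G[symmetric] by simp
  then have "(q - 1) * (2 * size \<G>) \<le> (q - 1) * size M" by (rule mult_left_mono) simp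
  ultimately have "2 * z \<le> (q - 1) * size M" by (simp add: algebra_simps)
  then have zZ: "z \<le> Z" using Z by linarith
  have "\<Sum>\<^sub># M + z * k = q * k * size \<G>" using splits_total[OF sp] by simp
  moreover have "\<Sum>\<^sub># M + Z * k = (\<Sum>\<^sub># M + z * k) + (Z - z) * k"
    using zZ by (simp add: diff_mult_distrib)
  ultimately have "q * k dvd (Z - z) * k" using dvd by (metis dvd_add_right_iff dvd_triv_left)
  then have "q dvd Z - z" using k by simp
  then obtain c where c: "Z - z = q * c" by (auto elim: dvdE)
  have "splits (q * k) c (repeat_mset c (replicate_mset q k))"
    by (rule splits_repeat) simp
  moreover have "repeat_mset c (replicate_mset q k) = replicate_mset (Z - z) k"
    by (rule multiset_eqI) (simp add: c)
  ultimately have "splits (q * k) (size \<G> + c) (M + replicate_mset z k + replicate_mset (Z - z) k)"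
    using splits_add[OF sp] by simp
  moreover have "M + replicate_mset z k + replicate_mset (Z - z) k = M + replicate_mset Z k"
    using zZ by (simp add: replicate_mset_add[symmetric] add.assoc)
  ultimately show ?thesis by metis
qed

section \<open>Multiples of the maximal size, and even maximal size\<close>

lemma sum_binomial_absorb:
  "(\<Sum>i=1..h. i * (Suc N choose i)) = Suc N * (\<Sum>j<h. N choose j)"
proof (induction h)
  case (Suc h)
  have "(\<Sum>i=1..Suc h. i * (Suc N choose i)) = Suc N * (\<Sum>j<h. N choose j) + Suc h * (Suc N choose Suc h)"
    using Suc.IH by (simp only: sum.cl_ivl_Suc) simp
  then show ?case unfolding Suc_times_binomial by (simp only: sum.lessThan_Suc distrib_left)
qed simp

lemma sum_mset_sum_replicate:
  "finite A \<Longrightarrow> \<Sum>\<^sub># (\<Sum>i\<in>A. replicate_mset (c i) (f i)) = (\<Sum>i\<in>A. c i * f i)" for f :: "'i \<Rightarrow> nat"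
  by (induction A rule: finite_induct) auto

lemma size_sum_replicate:
  "finite A \<Longrightarrow> size (\<Sum>i\<in>A. replicate_mset (c i) (f i)) = (\<Sum>i\<in>A. c i)"
  by (induction A rule: finite_induct) auto

lemma set_mset_sum_replicate:
  "finite A \<Longrightarrow> set_mset (\<Sum>i\<in>A. replicate_mset (c i) (f i)) \<subseteq> f ` A"
  by (induction A rule: finite_induct) auto

lemma image_mset_sum_replicate:
  "finite A \<Longrightarrow> image_mset g (\<Sum>i\<in>A. replicate_mset (c i) (f i)) = (\<Sum>i\<in>A. replicate_mset (c i) (g (f i)))"
  by (induction A rule: finite_induct) auto

lemma binomial_ratio_ge:
  assumes "k + p * k \<le> n + 1" and "0 < k"
  shows "p * (n choose (k - 1)) \<le> n choose k"
proof -
  obtain j where j: "k = Suc j" using assms(2) by (cases k) auto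
  have "Suc j * p \<le> n - j" using assms j by (simp add: algebra_simps)
  then have "Suc j * p * (n choose j) \<le> Suc j * (n choose Suc j)"
    unfolding binomial_absorb[symmetric] by (rule mult_right_mono) simp
  then show ?thesis by (simp only: j mult.assoc Suc_mult_le_cancel1) simp
qed

lemma sum_binomial_bound:
  assumes "3 * k \<le> n + 4"
  shows "(\<Sum>i=1..k - 1. n choose i) \<le> 2 * (n choose (k - 1))"
proof -
  have "(\<Sum>i=1..k - 1. n choose i) \<le> (\<Sum>i\<le>k - 1. n choose i)" by (rule sum_mono2) auto
  also have "\<dots> \<le> 2 * (n choose (k - 1))" using assms by (intro sum_binomial_le_double) simp
  finally show ?thesis .
qed

text \<open>If \<open>k \<le> q + 1\<close>, all sizes below \<open>k\<close> are at most \<open>q\<close>, and padding applies.  If \<open>k = q + 2\<close>, the size \<open>k - 1\<close> is too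
  large for that, but \<open>n choose (k - 1) = (k - 2) * (n choose (k - 2))\<close>, and one \<open>k - 2\<close> together with
  \<open>k - 2\<close> copies of \<open>k - 1\<close> has sum \<open>k * (k - 2) = n\<close>; this uses up both sizes.\<close>

lemma splits_multiple:
  fixes n k q :: nat
  assumes n: "n = q * k" and q: "3 \<le> q" "k \<le> q + 2" and k: "0 < k"
  shows "\<exists>N. splits n N (\<Sum>i=1..k. replicate_mset (n choose i) i)"
proof -
  define M where "M h = (\<Sum>i=1..h. replicate_mset (n choose i) i)" for h
  have n0: "0 < n" using n q k by simp
  then obtain N0 where N0: "n = Suc N0" by (cases n) auto
  have M_Suc: "M (Suc h) = M h + replicate_mset (n choose Suc h) (Suc h)" for h
    by (simp add: M_def)
  have Msum: "\<Sum>\<^sub># (M h) = n * (\<Sum>j<h. N0 choose j)" for h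
    using sum_binomial_absorb[of N0 h] by (simp add: M_def sum_mset_sum_replicate N0 mult.commute)
  have Msize: "size (M h) \<le> 2 * (n choose (k - 1))" if "h \<le> k - 1" for h
  proof -
    have "size (M h) = (\<Sum>i=1..h. n choose i)" by (simp add: M_def size_sum_replicate)
    also have "\<dots> \<le> (\<Sum>i=1..k - 1. n choose i)" using that by (intro sum_mono2) auto
    also have "\<dots> \<le> 2 * (n choose (k - 1))"
    proof (rule sum_binomial_bound)
      have "3 * k \<le> q * k" using q by simp
      then show "3 * k \<le> n + 4" using n by linarith
    qed
    finally show ?thesis .
  qed
  have pad: "\<exists>N. splits n N (M h + replicate_mset (n choose k) k)" if h: "h \<le> k - 1" "h \<le> q" for h
    unfolding n
  proof (rule splits_by_padding)
    have "set_mset (M h) \<subseteq> {1..h}"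
      using set_mset_sum_replicate[of "{1..h}" "\<lambda>i. n choose i" "\<lambda>i. i"] by (simp add: M_def)
    then show "0 < x \<and> x < k \<and> x \<le> q" if "x \<in># M h" for x
      using that h k by (auto dest!: subsetD)
    obtain j where j: "k = Suc j" using k by (cases k) auto
    have "(n choose k) * k = n * (N0 choose j)"
      using Suc_times_binomial[of j N0] by (simp add: N0 j mult.commute)
    then show "q * k dvd \<Sum>\<^sub># (M h) + (q * k choose k) * k"
      unfolding Msum n[symmetric] by simp
    have "(q - 1) * (n choose (k - 1)) \<le> n choose k"
    proof (rule binomial_ratio_ge[OF _ k])
      show "k + (q - 1) * k \<le> n + 1" using n q by (simp add: diff_mult_distrib)
    qed
    moreover have "(q - 1) * size (M h) \<le> (q - 1) * (2 * (n choose (k - 1)))"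
      using Msize[OF h(1)] by simp
    ultimately show "(q - 1) * size (M h) \<le> 2 * (q * k choose k)" unfolding n[symmetric] by linarith
  qed (use q k in auto)
  show ?thesis
  proof (cases "k \<le> q + 1")
    case True
    have "M k = M (k - 1) + replicate_mset (n choose k) k" using M_Suc[of "k - 1"] k by simp
    moreover obtain N where "splits n N (M (k - 1) + replicate_mset (n choose k) k)"
    proof -
      have "k - 1 \<le> q" using True by linarith
      then show ?thesis using pad[of "k - 1"] that by blast
    qed
    ultimately show ?thesis unfolding M_def[symmetric] by auto
  next
    case False
    then have kq: "k = q + 2" using q by simp
    obtain N where N: "splits n N (M (k - 3) + replicate_mset (n choose k) k)"
    proof -
      have "k - 3 \<le> k - 1" "k - 3 \<le> q" using kq by simp_all
      then show ?thesis using pad[of "k - 3"] that by blast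
    qed
    define h where "h = k - 3"
    have kh: "k = Suc (Suc (Suc h))" "q = Suc h" using kq q by (simp_all add: h_def)
    define T where "T = {#Suc h#} + replicate_mset (Suc h) (Suc (Suc h))"
    have "\<Sum>\<^sub># T = n" unfolding T_def n kh by simp
    then have T: "splits n (n choose Suc h) (repeat_mset (n choose Suc h) T)" by (intro splits_repeat) simp
    have "n - Suc h = Suc (Suc h) * Suc h" unfolding n kh by simp
    then have "Suc (Suc h) * (Suc h * (n choose Suc h)) = Suc (Suc h) * (n choose Suc (Suc h))"
      using binomial_absorb[of n "Suc h"] by (metis mult.assoc)
    then have c: "n choose Suc (Suc h) = (n choose Suc h) * Suc h" by (simp only: mult_cancel1) (simp add: algebra_simps)
    have "repeat_mset (n choose Suc h) T =
       replicate_mset (n choose Suc h) (Suc h) + replicate_mset (n choose Suc (Suc h)) (Suc (Suc h))"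
      unfolding c T_def by (rule multiset_eqI) simp
    then have "M k = M (k - 3) + replicate_mset (n choose k) k + repeat_mset (n choose Suc h) T"
      unfolding kh(1) M_Suc by (simp add: ac_simps)
    then show ?thesis unfolding M_def[symmetric] using splits_add[OF N T] by auto
  qed
qed

lemma splits_double:
  assumes "splits n N M"
  shows "splits (2 * n) N (image_mset (\<lambda>x. 2 * x) M)"
proof -
  obtain F where F: "size F = N" "\<forall>T\<in>#F. \<Sum>\<^sub># T = n" "\<Sum>\<^sub># F = M"
    using assms unfolding splits_def by blast
  have dbl: "\<Sum>\<^sub># (image_mset (\<lambda>x. 2 * x) T) = 2 * \<Sum>\<^sub># T" for T :: "nat multiset"
    by (induction T) auto
  have "\<Sum>\<^sub># (image_mset (image_mset (\<lambda>x. 2 * x)) F) = image_mset (\<lambda>x. 2 * x) (\<Sum>\<^sub># F)"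
    by (induction F) auto
  then show ?thesis using F dbl unfolding splits_def
    by (intro exI[of _ "image_mset (image_mset (\<lambda>x. 2 * x)) F"]) auto
qed

lemma even_binomial_sum: "(\<Sum>a=1..h. 2 * a * (Suc N choose (2 * a))) = Suc N * (\<Sum>a=1..h. N choose (2 * a - 1))"
proof -
  have "2 * a * (Suc N choose (2 * a)) = Suc N * (N choose (2 * a - 1))" if "a \<in> {1..h}" for a
    using that Suc_times_binomial[of "2 * a - 1" N] by simp
  then show ?thesis unfolding sum_distrib_left by (intro sum.cong) auto
qed

text \<open>After division by \<open>2\<close> the sizes are \<open>1, \<dots>, r\<close> and the required sum is \<open>q * r\<close>; sizes below \<open>r\<close> are at
  most \<open>q\<close>, as padding modulo \<open>r\<close> demands.\<close>

lemma splits_even_sizes: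
  fixes m r q :: nat
  assumes m: "m = q * (2 * r)" and q: "3 \<le> q" "r \<le> q + 1" and r: "0 < r"
  shows "\<exists>N. splits m N (\<Sum>a=1..r. replicate_mset (m choose (2 * a)) (2 * a))"
proof -
  define M where "M h = (\<Sum>a=1..h. replicate_mset (m choose (2 * a)) a)" for h
  have m0: "0 < m" using m q r by simp
  then obtain N0 where N0: "m = Suc N0" by (cases m) auto
  obtain s where s: "r = Suc s" using r by (cases r) auto
  have M_Suc: "M r = M s + replicate_mset (m choose (2 * r)) r"
    by (simp add: M_def s)
  have q6: "6 * r \<le> m" using q m by simp
  have "\<exists>N. splits (q * r) N (M s + replicate_mset (m choose (2 * r)) r)"
  proof (rule splits_by_padding)
    have "set_mset (M s) \<subseteq> {1..s}"
      using set_mset_sum_replicate[of "{1..s}" "\<lambda>a. m choose (2 * a)" "\<lambda>a. a"] by (simp add: M_def)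
    then show "0 < x \<and> x < r \<and> x \<le> q" if "x \<in># M s" for x
      using that q s by (auto dest!: subsetD)
    have "2 * (\<Sum>\<^sub># (M s) + (m choose (2 * r)) * r) = (\<Sum>a=1..r. 2 * a * (m choose (2 * a)))"
      by (simp add: M_def sum_mset_sum_replicate s sum_distrib_left algebra_simps)
    also have "\<dots> = 2 * (q * r * (\<Sum>a=1..r. N0 choose (2 * a - 1)))"
      unfolding N0 even_binomial_sum unfolding N0[symmetric] m by (simp only: mult.assoc mult.left_commute)
    finally have "\<Sum>\<^sub># (M s) + (m choose (2 * r)) * r = q * r * (\<Sum>a=1..r. N0 choose (2 * a - 1))"
      by simp
    then show "q * r dvd \<Sum>\<^sub># (M s) + (m choose (2 * r)) * r" by simp
    have "size (M s) = (\<Sum>a=1..s. m choose (2 * a))" by (simp add: M_def size_sum_replicate)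
    also have "\<dots> = (\<Sum>i\<in>(\<lambda>a. 2 * a) ` {1..s}. m choose i)" by (subst sum.reindex) (auto simp: inj_on_def)
    also have "\<dots> \<le> (\<Sum>i\<le>2 * s. m choose i)" by (rule sum_mono2) auto
    also have "\<dots> \<le> 2 * (m choose (2 * s))" using q6 s by (intro sum_binomial_le_double) simp
    also have "\<dots> \<le> m choose Suc (2 * s)" using q6 s by (intro binomial_double) simp
    finally have "(q - 1) * size (M s) \<le> (q - 1) * (m choose Suc (2 * s))" by simp
    also have "\<dots> = (q - 1) * (m choose (2 * r - 1))" by (simp add: s)
    also have "\<dots> \<le> m choose (2 * r)"
    proof (rule binomial_ratio_ge)
      show "2 * r + (q - 1) * (2 * r) \<le> m + 1" using m q by (simp add: diff_mult_distrib)
    qed (use r in simp)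
    finally show "(q - 1) * size (M s) \<le> 2 * (m choose (2 * r))" by simp
  qed (use q r in auto)
  then obtain N where "splits (q * r) N (M r)" unfolding M_Suc by blast
  then have "splits (2 * (q * r)) N (image_mset (\<lambda>x. 2 * x) (M r))" by (rule splits_double)
  moreover have "2 * (q * r) = m" by (simp add: m)
  ultimately show ?thesis by (auto simp: M_def image_mset_sum_replicate)
qed

section \<open>Odd maximal size\<close>

lemma sum_binomial_le_three_halves:
  "4 * j \<le> n + 1 \<Longrightarrow> 2 * (\<Sum>i\<le>j. n choose i) \<le> 3 * (n choose j)"
proof (induction j)
  case (Suc j)
  have "3 * Suc j \<le> n - j" using Suc.prems by simp
  then have "3 * Suc j * (n choose j) \<le> Suc j * (n choose Suc j)"
    unfolding binomial_absorb[symmetric] by (rule mult_right_mono) simp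
  then have "Suc j * (3 * (n choose j)) \<le> Suc j * (n choose Suc j)"
    by (simp only: mult.assoc mult.left_commute)
  then have "3 * (n choose j) \<le> n choose Suc j" by (simp only: Suc_mult_le_cancel1)
  then show ?case using Suc by simp
qed simp

lemma odd_binomial_sum:
  "(\<Sum>i=1..2 * s. if odd i then Suc N choose i else 0) = (\<Sum>j<2 * s. N choose j)"
  by (induction s) simp_all

lemma repeat_replicate: "repeat_mset c (replicate_mset a x) = replicate_mset (c * a) x"
  by (rule multiset_eqI) simp

lemma sum_replicate_same: "finite A \<Longrightarrow> (\<Sum>i\<in>A. replicate_mset (c i) x) = replicate_mset (\<Sum>i\<in>A. c i) x"
  by (induction A rule: finite_induct) (auto simp: replicate_mset_add)

text \<open>In \<open>splits_odd\<close> some edges of the largest size \<open>h = k - 3\<close> are used differently from the others.\<close>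

lemma sum_lower_last:
  fixes c g :: "nat \<Rightarrow> nat"
  assumes "a = 0 \<or> 1 \<le> h \<and> a \<le> c h"
  shows "(\<Sum>i=1..h. (if i = h then c i - a else c i) * g i) + a * g h = (\<Sum>i=1..h. c i * g i)"
proof (cases "a = 0")
  case True
  then show ?thesis by (auto intro: sum.cong)
next
  case False
  then obtain h' where h: "h = Suc h'" "a \<le> c h" using assms by (cases h) auto
  have "(\<Sum>i=1..h'. (if i = h then c i - a else c i) * g i) = (\<Sum>i=1..h'. c i * g i)"
    using h(1) by (intro sum.cong) auto
  moreover have "(c h - a) * g h + a * g h = c h * g h"
    using h(2) by (metis add_mult_distrib le_add_diff_inverse2)
  ultimately show ?thesis using h(1) by simp
qed

text \<open>This bounds the multiplicity \<open>\<alpha>\<close> in \<open>splits_odd\<close> by half the number of edges of size \<open>k - 3\<close>.  With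
  \<open>c1, c2, c3\<close> for \<open>N choose (k - 3), N choose (k - 4), N choose (k - 5)\<close> and \<open>D\<close> for the sum of \<open>N choose j\<close>
  over \<open>j \<le> k - 5\<close>, which is at most \<open>3 / 2 * c3\<close>, it comes down to \<open>(q - 1) * c2 + q * D \<le> c1\<close>.  The
  ratio \<open>c2 / c1\<close> is about \<open>1 / q\<close>, and after multiplication by \<open>k\<close> the first term leaves a margin
  of \<open>3 * c1\<close> for the second one.\<close>

lemma odd_case_binomial_bound:
  fixes N k q :: nat
  assumes N: "N + 2 = q * k" and q: "3 \<le> q" "k \<le> 2 * q + 1" and k: "5 \<le> k"
  shows "q * (N choose (k - 3)) + q * (\<Sum>j<k - 3. N choose j)
    \<le> (Suc N choose (k - 2)) + (N choose (k - 4))"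
proof -
  obtain h where h: "k = h + 5" using le_Suc_ex[OF k] by (auto simp: add.commute)
  obtain p where p: "q = Suc p" using q(1) by (cases q) auto
  define c1 c2 c3 where "c1 = (N choose (k - 3))" "c2 = (N choose (k - 4))" "c3 = (N choose (k - 5))"
  note c = c1_c2_c3_def
  define D where "D = (\<Sum>j\<le>k - 5. N choose j)"
  define X where "X = p * k + 2"
  have S: "(\<Sum>j<k - 3. N choose j) = c2 + D"
    unfolding c D_def h by (simp add: lessThan_Suc_atMost)
  have "N - (h + 1) = X" using N unfolding X_def p h by simp
  then have e1: "X * c2 = (h + 2) * c1" using binomial_absorb[of N "h + 1"] by (simp add: c h)
  have "N - h = X + 1" using N unfolding X_def p h by simp
  then have e2: "(X + 1) * c3 = (h + 1) * c2" using binomial_absorb[of N h] by (simp add: c h)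
  have hp: "h + 2 \<le> 2 * p" using q(2) by (simp add: h p)
  have "4 * h \<le> N + 1"
  proof (cases "q = 3")
    case True
    then show ?thesis using hp N by (simp add: h p)
  next
    case False
    then have "4 * k \<le> q * k" using q by simp
    then show ?thesis using N by (simp add: h)
  qed
  then have D: "2 * D \<le> 3 * c3"
    using sum_binomial_le_three_halves[of h N] by (simp add: D_def c h)
  have "X * ((X + 1) * c3) = (h + 1) * (X * c2)" unfolding e2 by (simp add: algebra_simps)
  then have e3: "X * (X + 1) * c3 = (h + 1) * (h + 2) * c1" unfolding e1 by (simp add: algebra_simps)
  have "k * q * ((h + 1) * (h + 2)) \<le> 2 * (X * (X + 1))"
  proof -
    have "k * q * ((h + 1) * (h + 2)) = (h + 2) * k * (q * (h + 1))" by (simp add: algebra_simps)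
    also have "\<dots> \<le> (2 * p) * k * (q * (h + 1))" using hp by (intro mult_right_mono) auto
    also have "\<dots> \<le> 2 * X * (q * (h + 1))" unfolding X_def by (intro mult_right_mono) auto
    also have "\<dots> \<le> 2 * X * (X + 1)"
      using hp unfolding X_def p h by (intro mult_left_mono) (auto simp: algebra_simps)
    finally show ?thesis by (simp add: mult.assoc)
  qed
  then have "k * q * ((h + 1) * (h + 2)) * c1 \<le> 2 * (X * (X + 1)) * c1" by (rule mult_right_mono) simp
  moreover have "X * (X + 1) * (k * q * c3) = k * q * ((h + 1) * (h + 2)) * c1"
  proof -
    have "X * (X + 1) * (k * q * c3) = k * q * (X * (X + 1) * c3)" by (simp add: algebra_simps)
    then show ?thesis unfolding e3 by (simp add: algebra_simps)
  qed
  ultimately have "X * (X + 1) * (k * q * c3) \<le> X * (X + 1) * (2 * c1)" by (simp add: algebra_simps)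
  moreover have "0 < X * (X + 1)" by (simp add: X_def)
  ultimately have "k * q * c3 \<le> 2 * c1" by (simp only: nat_mult_le_cancel1)
  moreover have "k * q * (2 * D) \<le> k * q * (3 * c3)" by (rule mult_left_mono[OF D]) simp
  then have "2 * (k * q * D) \<le> 3 * (k * q * c3)" by (simp only: mult.left_commute[of "k * q"])
  ultimately have kqD: "k * q * D \<le> 3 * c1" by linarith
  have "p * k * c2 \<le> (h + 2) * c1" unfolding e1[symmetric] X_def by (intro mult_right_mono) auto
  then have "k * (p * c2 + q * D) \<le> k * c1"
    using kqD by (simp add: h algebra_simps)
  then have 1: "p * c2 + q * D \<le> c1" using k by simp
  have "(h + 3) * (q + 1) \<le> Suc N" using q(2) N by (simp add: h algebra_simps)
  then have "(h + 3) * ((q + 1) * c1) \<le> Suc N * c1" by (metis mult.assoc mult_right_mono zero_le)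
  also have "\<dots> = (h + 3) * (Suc N choose (k - 2))"
    using Suc_times_binomial[of "h + 2" N] by (simp add: c h eval_nat_numeral)
  finally have "(q + 1) * c1 \<le> Suc N choose (k - 2)" by simp
  then show ?thesis using 1 unfolding S c(1,2)[symmetric] by (simp add: p algebra_simps)
qed

text \<open>The factor types, besides fillers \<open>k\<close>, are the following.
  \<^item> \<open>T i\<close> for \<open>1 \<le> i \<le> k - 3\<close>: the size \<open>i\<close>, with \<open>(i + 1) div 2\<close> copies of \<open>k - 2\<close> and, for even \<open>i\<close>, one \<open>k - 1\<close>;
  \<^item> \<open>P\<close>: \<open>r + 1\<close> copies of \<open>k - 2\<close>;
  \<^item> \<open>B\<close>: \<open>r\<close> copies of \<open>k - 2\<close> and two of \<open>k - 1\<close>;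
  \<^item> \<open>A\<close>: two copies of \<open>k - 3\<close> and \<open>r - 2\<close> copies of \<open>k - 2\<close>;
  \<^item> \<open>F\<close>: one \<open>k - 1\<close>.

  If every size up to \<open>k - 3\<close> is used in the types \<open>T i\<close>, the remaining copies of \<open>k - 2\<close> have to go to
  \<open>P\<close> and \<open>B\<close>, and exhausting all sizes determines the multiplicities: \<open>b\<close> for \<open>B\<close> and \<open>C1 + b\<close> for \<open>P\<close>, where
  \<open>2 * b = (n choose (k - 2)) - (q + 1) * C1 - q * S\<close>, \<open>C1 = (n - 1) choose (k - 3)\<close>, and \<open>S\<close> is the
  sum of \<open>(n - 1) choose j\<close> over \<open>j < k - 3\<close>.  That \<open>k\<close> is odd makes the right-hand side
  even.  If it is negative, say \<open>- 2 * \<alpha>\<close>, type \<open>A\<close> is used \<open>\<alpha>\<close> times instead of \<open>B\<close>: each use takes two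
  copies of \<open>k - 3\<close> from \<open>T (k - 3)\<close> and replaces one use of \<open>P\<close>.  Both cases are treated at once, with
  \<open>\<alpha> = 0\<close> or \<open>b = 0\<close>.\<close>

lemma splits_odd:
  fixes n k q r :: nat
  assumes n: "n + 1 = q * k" and kr: "k = 2 * r + 1" and r: "0 < r" "r \<le> q" and q: "3 \<le> q"
  shows "\<exists>N. splits n N (\<Sum>i=1..k. replicate_mset (n choose i) i)"
proof -
  have "3 * k \<le> q * k" using q by simp
  then have nk: "3 * k \<le> n + 1" using n by simp
  then obtain N0 where N0: "n = Suc N0" using kr by (cases n) auto
  define h where "h = 2 * r - 2"
  have kh: "k = Suc (Suc (Suc h))" and hr: "h = 2 * (r - 1)" using kr r by (simp_all add: h_def)
  define c where "c i = (n choose i)" for i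
  define C1 where "C1 = (N0 choose h)"
  define S where "S = (\<Sum>j<h. N0 choose j)"
  \<comment> \<open>\<open>\<tau> i\<close> and \<open>\<epsilon> i\<close> count the copies of \<open>k - 2\<close> and of \<open>k - 1\<close> in \<open>T i\<close>\<close>
  define \<tau> where "\<tau> i = (i + 1) div 2" for i :: nat
  define \<epsilon> where "\<epsilon> i = (if even i then 1 else 0 :: nat)" for i :: nat
  define U where "U = (\<Sum>i=1..h. c i * \<tau> i)"
  define e where "e = (\<Sum>i=1..h. c i * \<epsilon> i)"

  have absorb: "(2 * r - 1) * c (k - 2) = n * C1"
  proof -
    have "2 * r - 1 = Suc h" "k - 2 = Suc h" using kr r by (simp_all add: h_def)
    then show ?thesis unfolding c_def C1_def N0 by (simp only: Suc_times_binomial)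
  qed
  have odd_sum: "(\<Sum>i=1..h. c i * (1 - \<epsilon> i)) = S"
  proof -
    have "(\<Sum>i=1..h. c i * (1 - \<epsilon> i)) = (\<Sum>i=1..h. if odd i then Suc N0 choose i else 0)"
      by (intro sum.cong) (auto simp: c_def N0 \<epsilon>_def)
    then show ?thesis using odd_binomial_sum[of N0 "r - 1"] unfolding hr[symmetric] S_def by simp
  qed
  have all: "(\<Sum>i=1..h. c i) = e + S"
    unfolding e_def odd_sum[symmetric] sum.distrib[symmetric] by (intro sum.cong) (auto simp: \<epsilon>_def)
  have "2 * \<tau> i = i + (1 - \<epsilon> i)" for i by (auto simp: \<tau>_def \<epsilon>_def elim!: evenE oddE)
  then have "2 * U = (\<Sum>i=1..h. c i * (i + (1 - \<epsilon> i)))"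
    unfolding U_def sum_distrib_left by (metis (no_types, lifting) mult.left_commute)
  also have "\<dots> = (\<Sum>i=1..h. i * (Suc N0 choose i)) + S"
    unfolding odd_sum[symmetric] sum.distrib[symmetric]
    by (intro sum.cong) (auto simp: c_def N0 algebra_simps)
  also have "\<dots> = n * S + S" unfolding sum_binomial_absorb by (simp add: S_def N0)
  also have "\<dots> = (n + 1) * S" by simp
  finally have U: "2 * U = k * (q * S)" unfolding n by (simp add: algebra_simps)

  have "\<exists>\<alpha> b :: nat. 2 * b + (q + 1) * C1 + q * S = c (k - 2) + 2 * \<alpha> \<and> (\<alpha> = 0 \<or> b = 0)"
  proof -
    define y where "y = int (c (k - 2)) - (int q + 1) * int C1 - int q * int S"
    have a: "(int k - 2) * int (c (k - 2)) = (int q * int k - 1) * int C1"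
    proof -
      have "int (2 * r - 1) * int (c (k - 2)) = int n * int C1" using absorb by (metis of_nat_mult)
      moreover have "int (2 * r - 1) = int k - 2" using kr r by simp
      moreover have "int n = int q * int k - 1" using n by (metis add_diff_cancel_right' of_nat_1 of_nat_add of_nat_mult)
      ultimately show ?thesis by simp
    qed
    have u: "2 * int U = int k * (int q * int S)" using U by (metis of_nat_mult of_nat_numeral)
    have "int k * y = 2 * int (c (k - 2)) - (int k + 1) * int C1 - 2 * int U"
      using a u by (simp add: y_def algebra_simps)
    also have "\<dots> = 2 * (int (c (k - 2)) - (int r + 1) * int C1 - int U)"
      by (simp add: kr algebra_simps)
    finally have "even (int k * y)" by simp
    then have "even y" using kr by simp
    then obtain x where x: "y = 2 * x" by blast
    show ?thesis
    proof (cases "0 \<le> x")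
      case True
      then have "2 * nat x + (q + 1) * C1 + q * S = c (k - 2) + 2 * 0"
        using x unfolding y_def by (intro int_int_eq[THEN iffD1]) (simp add: algebra_simps)
      then show ?thesis by blast
    next
      case False
      then have "2 * 0 + (q + 1) * C1 + q * S = c (k - 2) + 2 * nat (- x)"
        using x unfolding y_def by (intro int_int_eq[THEN iffD1]) (simp add: algebra_simps)
      then show ?thesis by blast
    qed
  qed
  then obtain \<alpha> b :: nat where ab: "2 * b + (q + 1) * C1 + q * S = c (k - 2) + 2 * \<alpha>"
    and ab0: "\<alpha> = 0 \<or> b = 0" by blast

  have qC1: "(q + 1) * C1 \<le> c (k - 2)"
  proof -
    have "(2 * r - 1) * (q + 1) \<le> n"
      using n r kr by (cases r) (auto simp: algebra_simps)
    then have "(2 * r - 1) * (q + 1) * C1 \<le> n * C1" by (rule mult_right_mono) simp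
    then have "(2 * r - 1) * ((q + 1) * C1) \<le> (2 * r - 1) * c (k - 2)" unfolding absorb by (simp only: mult.assoc)
    then show ?thesis using r by simp
  qed
  have \<alpha>: "\<alpha> = 0 \<or> 2 \<le> r \<and> 2 * \<alpha> \<le> c h \<and> \<alpha> \<le> C1"
  proof (cases "\<alpha> = 0")
    case False
    then have b: "b = 0" using ab0 by simp
    have "r \<noteq> 1"
    proof
      assume "r = 1"
      then have "S = 0" by (simp add: S_def h_def)
      then show False using ab b qC1 False by simp
    qed
    then have r2: "2 \<le> r" using r by simp
    then obtain h' where h': "h = Suc h'" by (cases h) (auto simp: h_def)
    have "q * C1 + q * S \<le> c (k - 2) + (N0 choose h')"
    proof -
      have "q * (N0 choose (k - 3)) + q * (\<Sum>j<k - 3. N0 choose j)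
          \<le> (Suc N0 choose (k - 2)) + (N0 choose (k - 4))"
        using n N0 q r r2 kr by (intro odd_case_binomial_bound) auto
      moreover have "k - 3 = h" "k - 4 = h'" using kh h' by simp_all
      ultimately show ?thesis unfolding C1_def S_def c_def N0 by simp
    qed
    then have "2 * \<alpha> \<le> C1 + (N0 choose h')" using ab b by simp
    moreover have "c h = C1 + (N0 choose h')" by (simp add: c_def C1_def N0 h')
    moreover have "2 * (N0 choose h') \<le> N0 choose h"
      unfolding h' using nk kh h' N0 by (intro binomial_double) simp
    ultimately show ?thesis using r2 by (simp add: C1_def)
  qed simp
  \<comment> \<open>type \<open>B\<close> does not fit for \<open>r = q\<close>\<close>
  have bq: "b = 0 \<or> r < q"
  proof (cases "r = q")
    case True
    have "(2 * r - 1) * (r + 1) = n" using n r kr True by (cases r) (auto simp: algebra_simps)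
    then have "(2 * r - 1) * c (k - 2) = (2 * r - 1) * ((r + 1) * C1)"
      unfolding absorb by (metis mult.assoc)
    then have "c (k - 2) = (q + 1) * C1" using r True by simp
    then have "2 * b + q * S = 2 * \<alpha>" using ab by simp
    then show ?thesis using ab0 by auto
  qed (use r in simp)

  have ones: "e + 2 * b \<le> c (k - 1)"
  proof -
    have "e \<le> (\<Sum>i\<le>h. n choose i)"
    proof -
      have "e \<le> (\<Sum>i=1..h. c i)" unfolding all by simp
      also have "\<dots> \<le> (\<Sum>i\<le>h. c i)" by (rule sum_mono2) auto
      finally show ?thesis by (simp add: c_def)
    qed
    also have "\<dots> \<le> 2 * (n choose h)" using nk kh by (intro sum_binomial_le_double) simp
    also have "\<dots> \<le> c (k - 2)" unfolding c_def kh using nk kh binomial_double[of h n] by simp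
    finally have "e \<le> c (k - 2)" .
    moreover have "2 * b \<le> c (k - 2)" using ab ab0 by auto
    moreover have "2 * c (k - 2) \<le> c (k - 1)" unfolding c_def kh using nk kh binomial_double[of "Suc h" n] by simp
    ultimately show ?thesis by simp
  qed

  \<comment> \<open>the multiplicity of \<open>T i\<close>\<close>
  define m where "m i = (if i = h then c i - 2 * \<alpha> else c i)" for i
  have low: "(\<Sum>i=1..h. m i * g i) + 2 * \<alpha> * g h = (\<Sum>i=1..h. c i * g i)" for g
    unfolding m_def using \<alpha> by (intro sum_lower_last) (auto simp: h_def)
  define T where "T i = {#i#} + replicate_mset (\<tau> i) (k - 2) + replicate_mset (\<epsilon> i) (k - 1)
     + replicate_mset (q - \<tau> i - \<epsilon> i) k" for i
  define A where "A = replicate_mset 2 h + replicate_mset (r - 2) (k - 2) + replicate_mset (q + 1 - r) k"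
  define P where "P = replicate_mset (r + 1) (k - 2) + replicate_mset (q - r) k"
  define B where "B = replicate_mset r (k - 2) + replicate_mset 2 (k - 1) + replicate_mset (q - 1 - r) k"
  define F where "F = replicate_mset 1 (k - 1) + replicate_mset (q - 1) k"
  have Tsum: "\<Sum>\<^sub># (T i) = n" if "i \<in> {1..h}" for i
  proof (cases "even i")
    case True
    then obtain j where j: "i = 2 * j" by blast
    then have "j + 1 \<le> q" using that r by (auto simp: h_def)
    then obtain d where d: "q = j + 1 + d" using le_Suc_ex by blast
    show ?thesis using n r kr by (cases r) (auto simp: T_def \<tau>_def \<epsilon>_def j d algebra_simps)
  next
    case False
    then obtain j where j: "i = 2 * j + 1" by (auto elim: oddE)
    then have "j + 1 \<le> q" using that r by (auto simp: h_def)
    then obtain d where d: "q = j + 1 + d" using le_Suc_ex by blast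
    show ?thesis using n r kr by (cases r) (auto simp: T_def \<tau>_def \<epsilon>_def j d algebra_simps)
  qed
  have Asum: "\<alpha> = 0 \<or> \<Sum>\<^sub># A = n"
  proof (cases "\<alpha> = 0")
    case False
    then obtain r' where r': "r = r' + 2" using \<alpha> le_Suc_ex by (metis add.commute)
    obtain d where d: "q = r + d" using r le_Suc_ex by blast
    show ?thesis using n by (auto simp: A_def h_def kr d r' algebra_simps)
  qed simp
  have Psum: "\<Sum>\<^sub># P = n"
  proof -
    obtain d where d: "q = r + d" using r le_Suc_ex by blast
    show ?thesis using n r by (cases r) (auto simp: P_def kr d algebra_simps)
  qed
  have Bsum: "b = 0 \<or> \<Sum>\<^sub># B = n"
  proof (cases "b = 0")
    case False
    then have "r + 1 \<le> q" using bq by simp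
    then obtain d where d: "q = r + 1 + d" using le_Suc_ex by blast
    show ?thesis using n r by (cases r) (auto simp: B_def kr d algebra_simps)
  qed simp
  have Fsum: "\<Sum>\<^sub># F = n"
    using n q kr by (cases q) (auto simp: F_def algebra_simps)

  \<comment> \<open>the multiplicities of \<open>P\<close> and \<open>F\<close>\<close>
  define p where "p = C1 + b - \<alpha>"
  define f where "f = c (k - 1) + 2 * \<alpha> - e - 2 * b"
  have p: "p + \<alpha> = C1 + b" using \<alpha> by (auto simp: p_def)
  have f: "f + e + 2 * b = c (k - 1) + 2 * \<alpha>" using ones by (simp add: f_def)
  define MT where "MT = (\<Sum>i=1..h. repeat_mset (m i) (T i))"
  define M where "M = MT + repeat_mset \<alpha> A + repeat_mset p P + repeat_mset b B + repeat_mset f F"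
  define N where "N = (\<Sum>i=1..h. m i) + \<alpha> + p + b + f"
  have sp: "splits n N M"
    unfolding N_def M_def MT_def
    by (intro splits_add splits_sum splits_repeat Asum Bsum disjI2[OF Psum] disjI2[OF Fsum] disjI2[OF Tsum]) auto
  have Mh: "(\<Sum>i=1..h. replicate_mset (m i) i) + replicate_mset (2 * \<alpha>) h = (\<Sum>i=1..h. replicate_mset (c i) i)"
  proof (rule multiset_eqI)
    fix x
    have "2 * \<alpha> = 0 \<or> h \<in> {1..h} \<and> 2 * \<alpha> \<le> c h" using \<alpha> by (auto simp: h_def)
    then show "count ((\<Sum>i=1..h. replicate_mset (m i) i) + replicate_mset (2 * \<alpha>) h) x =
        count (\<Sum>i=1..h. replicate_mset (c i) i) x"
      by (auto simp: count_sum_replicate m_def)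
  qed
  define Z where "Z = (\<Sum>i=1..h. m i * (q - \<tau> i - \<epsilon> i)) + \<alpha> * (q + 1 - r) + p * (q - r) + b * (q - 1 - r) + f * (q - 1)"
  have MTe: "MT = (\<Sum>i=1..h. replicate_mset (m i) i) + replicate_mset (\<Sum>i=1..h. m i * \<tau> i) (k - 2) +
     replicate_mset (\<Sum>i=1..h. m i * \<epsilon> i) (k - 1) + replicate_mset (\<Sum>i=1..h. m i * (q - \<tau> i - \<epsilon> i)) k"
    unfolding MT_def T_def by (simp add: repeat_replicate sum.distrib sum_replicate_same)
  have twos: "(\<Sum>i=1..h. m i * \<tau> i) + \<alpha> * (r - 2) + p * (r + 1) + b * r = c (k - 2)"
  proof -
    have "\<tau> h = r - 1" by (simp add: \<tau>_def h_def)
    then have l: "(\<Sum>i=1..h. m i * \<tau> i) + 2 * \<alpha> * (r - 1) = U" using low[of \<tau>] by (simp add: U_def)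
    have "(2 * r - 1) * c (k - 2) + C1 = q * k * C1" using absorb n
      by (metis Suc_eq_plus1 add.commute mult_Suc)
    then have "k * c (k - 2) + C1 = 2 * c (k - 2) + q * k * C1" using r by (cases r) (auto simp: kr)
    moreover have "k * (2 * b + (q + 1) * C1 + q * S) = k * (c (k - 2) + 2 * \<alpha>)" unfolding ab ..
    ultimately have star: "k * b + (r + 1) * C1 + U = c (k - 2) + k * \<alpha>"
      using U by (simp add: kr algebra_simps)
    have pr: "p * (r + 1) + \<alpha> * (r + 1) = (C1 + b) * (r + 1)" using p by (metis add_mult_distrib)
    show ?thesis
    proof (cases "\<alpha> = 0")
      case True
      then show ?thesis using star pr l by (simp add: kr algebra_simps)
    next
      case False
      then obtain r' where "r = r' + 2" using \<alpha> le_Suc_ex by (metis add.commute)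
      then show ?thesis using star pr l by (simp add: kr algebra_simps)
    qed
  qed
  have onesM: "(\<Sum>i=1..h. m i * \<epsilon> i) + 2 * b + f = c (k - 1)"
  proof -
    have "\<epsilon> h = 1" by (simp add: \<epsilon>_def h_def)
    then show ?thesis using low[of \<epsilon>] f by (simp add: e_def)
  qed
  have M: "M = (\<Sum>i=1..h. replicate_mset (c i) i) + replicate_mset (c (k - 2)) (k - 2) +
      replicate_mset (c (k - 1)) (k - 1) + replicate_mset Z k"
    unfolding M_def MTe A_def P_def B_def F_def Z_def Mh[symmetric] twos[symmetric] onesM[symmetric]
    by (simp add: repeat_replicate replicate_mset_add mult.commute ac_simps)
  \<comment> \<open>\<open>N\<close> is the number of edges at a vertex; hence \<open>M\<close> has the right sum, and \<open>Z\<close> is the right number of fillers\<close>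
  have "N = (\<Sum>j<k. N0 choose j)"
  proof -
    have "(\<Sum>i=1..h. m i) + 2 * \<alpha> = e + S" using low[of "\<lambda>_. 1"] all by simp
    moreover have "(\<Sum>j<k. N0 choose j) = S + C1 + c (k - 1)"
      by (simp add: kh S_def C1_def c_def N0)
    ultimately show ?thesis using p f by (simp add: N_def)
  qed
  then have "\<Sum>\<^sub># M = (\<Sum>i=1..k. i * c i)"
    using splits_total[OF sp] sum_binomial_absorb[of N0 k] by (simp add: c_def N0)
  then have "Z * k = c k * k"
    unfolding M by (simp add: kh sum_mset_sum_replicate mult.commute)
  moreover have "k \<noteq> 0" using kr by simp
  ultimately have "Z = c k" using mult_right_cancel[of k Z "c k"] by blast
  then have "M = (\<Sum>i=1..k. replicate_mset (n choose i) i)"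
    unfolding M unfolding kh by (simp add: c_def)
  then show ?thesis using sp by blast
qed


section \<open>The characterization\<close>

theorem factorable_multiple:
  fixes n k q :: nat
  assumes "n = q * k" "3 \<le> q" "k \<le> q + 2" "0 < k"
  shows "one_factorable (complete_hypergraph_le n k)"
proof -
  obtain N where "splits n N (\<Sum>i=1..k. replicate_mset (n choose i) i)"
    using splits_multiple[OF assms] by blast
  then show ?thesis using assms by (intro factorable_of_splits_le) auto
qed

theorem factorable_pred_multiple:
  fixes n k q :: nat
  assumes n: "n + 1 = q * k" and q: "3 \<le> q" and k: "0 < k" "2 * k < n" "k \<le> 2 * q + 2"
  shows "one_factorable (complete_hypergraph_le n k)"
proof (cases "even k")
  case True
  then obtain r where r: "k = 2 * r" by blast
  have "\<exists>N. splits (n + 1) N (\<Sum>a=1..r. replicate_mset ((n + 1) choose (2 * a)) (2 * a))"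
    by (rule splits_even_sizes[of _ q]) (use n q k r in auto)
  then show ?thesis unfolding r using factorable_of_splits_even by blast
next
  case False
  then obtain r where r: "k = 2 * r + 1" by (auto elim: oddE)
  show ?thesis
  proof (cases "r = 0")
    case True
    show ?thesis
      by (rule factorable_multiple[of n n k]) (use k r True in auto)
  next
    case nz: False
    have "\<exists>N. splits n N (\<Sum>i=1..k. replicate_mset (n choose i) i)"
      by (rule splits_odd[OF n r]) (use q k r nz in auto)
    moreover have "0 < n" using n q k by (cases n) auto
    ultimately show ?thesis using factorable_of_splits_le by blast
  qed
qed

lemma ceiling_half: "\<lceil>real k / 2\<rceil> = int ((k + 1) div 2)"
proof (cases "even k")
  case True
  then show ?thesis by (auto elim!: evenE)
next
  case False
  then obtain r where r: "k = 2 * r + 1" by (auto elim: oddE)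
  have "\<lceil>real k / 2\<rceil> = int r + 1" unfolding r by (rule ceiling_unique) auto
  then show ?thesis by (simp add: r)
qed

text \<open>With \<open>n = q * k\<close> the first condition reads \<open>k \<le> q + 2\<close>; with \<open>n + 1 = q * k\<close> the second one reads
  \<open>k \<le> 2 * q + 2\<close> for either parity of \<open>k\<close>.\<close>

theorem theorem1p2:
  fixes n k :: nat
  assumes "n > 0" and "k > 0" and "real k < real n / 2"
  shows "one_factorable (complete_hypergraph_le n k) \<longleftrightarrow>
    ([int n = 0] (mod int k) \<and> int n \<ge> int k * (int k - 2)) \<or>
    ([int n = - 1] (mod int k) \<and> int n \<ge> int k * (\<lceil>real k / 2\<rceil> - 1) - 1)"
proof -
  have kn: "2 * k < n" using assms(3) by linarith
  have q3: "3 \<le> q" if "n \<le> q * k" for q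
  proof -
    have "2 * k < q * k" using kn that by linarith
    then show ?thesis by simp
  qed
  have A: "[int n = 0] (mod int k) \<and> int n \<ge> int k * (int k - 2) \<longleftrightarrow> (\<exists>q. n = q * k \<and> k \<le> q + 2)"
  proof -
    have "[int n = 0] (mod int k) \<longleftrightarrow> k dvd n" by (simp add: cong_0_iff)
    moreover have "int n \<ge> int k * (int k - 2) \<longleftrightarrow> k \<le> q + 2" if "n = q * k" for q
    proof -
      have "int n = int k * int q" using that by simp
      then have "int n \<ge> int k * (int k - 2) \<longleftrightarrow> int k - 2 \<le> int q"
        using assms(2) by (simp only: mult_le_cancel_left_pos of_nat_0_less_iff)
      then show ?thesis by linarith
    qed
    ultimately show ?thesis by (auto elim!: dvdE simp: mult.commute)
  qed
  have B: "[int n = - 1] (mod int k) \<and> int n \<ge> int k * (\<lceil>real k / 2\<rceil> - 1) - 1 \<longleftrightarrow>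
     (\<exists>q. n + 1 = q * k \<and> k \<le> 2 * q + 2)"
  proof -
    have "[int n = - 1] (mod int k) \<longleftrightarrow> int k dvd int (n + 1)"
      by (simp add: cong_iff_dvd_diff add.commute)
    then have "[int n = - 1] (mod int k) \<longleftrightarrow> k dvd n + 1" by (simp only: int_dvd_int_iff)
    moreover have "int n \<ge> int k * (\<lceil>real k / 2\<rceil> - 1) - 1 \<longleftrightarrow> k \<le> 2 * q + 2" if "n + 1 = q * k" for q
    proof -
      have "int n + 1 = int k * int q" using that by (metis mult.commute of_nat_1 of_nat_add of_nat_mult)
      then have "int n \<ge> int k * (\<lceil>real k / 2\<rceil> - 1) - 1 \<longleftrightarrow> int k * (\<lceil>real k / 2\<rceil> - 1) \<le> int k * int q"
        by linarith
      also have "\<dots> \<longleftrightarrow> int ((k + 1) div 2) - 1 \<le> int q"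
        unfolding ceiling_half using assms(2) by (simp only: mult_le_cancel_left_pos of_nat_0_less_iff)
      also have "\<dots> \<longleftrightarrow> k \<le> 2 * q + 2" by linarith
      finally show ?thesis .
    qed
    ultimately show ?thesis by (auto elim!: dvdE simp: mult.commute)
  qed
  show ?thesis unfolding A B
  proof
    assume "one_factorable (complete_hypergraph_le n k)"
    then show "(\<exists>q. n = q * k \<and> k \<le> q + 2) \<or> (\<exists>q. n + 1 = q * k \<and> k \<le> 2 * q + 2)"
      using factorable_imp_conditions assms(2) kn by blast
  next
    assume "(\<exists>q. n = q * k \<and> k \<le> q + 2) \<or> (\<exists>q. n + 1 = q * k \<and> k \<le> 2 * q + 2)"
    then show "one_factorable (complete_hypergraph_le n k)"
    proof (elim disjE exE conjE)
      fix q assume "n = q * k" "k \<le> q + 2"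
      then show ?thesis using factorable_multiple q3[of q] assms(2) by simp
    next
      fix q assume "n + 1 = q * k" "k \<le> 2 * q + 2"
      then show ?thesis using factorable_pred_multiple[of n q k] q3[of q] assms(2) kn by simp
    qed
  qed
qed

end
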